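(* Let $U$ be a reflexive Banach space, $V$ a uniformly smooth Banach space, and let assumptions (a1)–(a6) of the context hold. For noise levels $\delta>0$ let $v^\delta\in V$ satisfy $\|v-v^\delta\|\le\delta$ and consider the noisy iteration of the context; the case $\delta=0$ (superscript omitted) denotes the exact-data iteration of the context. Assume that $$\vartheta_5=1-\Big(\frac{\mathcal C}{c_0}\Big)^{1/p}\vartheta_4-\eta-\frac{\vartheta_1^{p^*-1}}{p^*(2c_0)^{p^*-1}}-\frac{\big(\frac{\mathcal C}{c_0}\big)^{1/p}\vartheta_4+(1+\eta)}{\tau}>0,$$ and that, for some constant $\zeta>1$, the combination parameters satisfy for all $k\ge0$ (and all $\delta\ge 0$) $$\frac{\lambda_k^\delta+(\lambda_k^\delta)^{p^*}}{p^*(2c_0)^{p^*-1}}\|\gamma_k^\delta-\gamma_{k-1}^\delta\|^{p^*}\le \frac{\vartheta_5\upsilon_k^\delta}{\zeta}\|F(w_k^\delta)-v^\delta\|^{s},\qquad \frac{\lambda_k^\delta+(\lambda_k^\delta)^{p^*}}{p^*(2c_0)^{p^*-1}}\|\gamma_k^\delta-\gamma_{k-1}^\delta\|^{p^*}\le c_0\epsilon^p ,$$ and $\sum_{k=0}^\infty\lambda_k\|\gamma_k-\gamma_{k-1}\|<\infty$. Moreover let $\lambda_k^\delta$ depend continuously on $\delta$ as $\delta\to0$ (i.e. $\lambda_k^\delta\to\lambda_k$ for each $k$), and let $\sum_{k=0}^\infty\alpha_k\|\gamma_0-\gamma_k\|<\infty$. Let the stopping index $k_\delta$ be chosen by the discrepancy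 principle $$\|F(w_{k_\delta}^\delta)-v^\delta\|\le\tau\delta<\|F(w_k^\delta)-v^\delta\|,\qquad 0\le k<k_\delta .$$ Then there exists a solution $\bar u$ of $F(u)=v$ in $B(u_0,2\epsilon)\cap D(\varphi)$ such that $$\lim_{\delta\to0}\mathcal D_{\gamma_{k_\delta}^\delta}\varphi(\bar u,u_{k_\delta}^\delta)=0\quad\text{and}\quad\lim_{\delta\to0}\|u_{k_\delta}^\delta-\bar u\|=0 .$$
   Context: Setting. $F:D(F)\subset U\to V$ is an operator between Banach spaces and $v\in V$ is such that $F(u)=v$ has a solution. $B(u_0,r)$ is the closed ball of radius $r$ about $u_0$. For a convex $\varphi:U\to(-\infty,\infty]$: $D(\varphi)=\{u:\varphi(u)<\infty\}$, $\partial\varphi$ is the subdifferential, $D(\partial\varphi)=\{u\in D(\varphi):\partial\varphi(u)\ne\emptyset\}$, $\varphi^*(\gamma)=\sup_{u\in U}\{\langle\gamma,u\rangle-\varphi(u)\}$ is the conjugate, and for $\gamma\in\partial\varphi(u)$ the Bregman distance is $\mathcal D_\gamma\varphi(\tilde u,u)=\varphi(\tilde u)-\varphi(u)-\langle\gamma,\tilde u-u\rangle$. For $p>1$ put $1/p+1/p^*=1$. For $1<s<\infty$, $J_s^V:V\to V^*$ is the duality mapping with gauge $t\mapsto t^{s-1}$, i.e. $\|J_s^V(x)\|=\|x\|^{s-1}$, $\langle J_s^V(x),x\rangle=\|x\|^s$ (single-valued since $V$ is uniformly smooth). Assumptions. (a1) $F$ is weakly closed on $D(F)$. (a2) $\varphi:U\to(-\infty,\infty]$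 is proper, weakly lower semicontinuous and $p$-convex with $p>1$, with $c_0>0$ such that $\mathcal D_\gamma\varphi(\tilde u,u)\ge c_0\|u-\tilde u\|^p$ for all $\tilde u\in U$, $u\in D(\partial\varphi)$, $\gamma\in\partial\varphi(u)$ (where $p$-convex means $\varphi(t\tilde u+(1-t)u)+t(1-t)c_0\|u-\tilde u\|^p\le t\varphi(\tilde u)+(1-t)\varphi(u)$ for all $u,\tilde u$ and $t\in[0,1]$). Then $\varphi^*$ is Fréchet differentiable on $U^*$, and $u=\nabla\varphi^*(\gamma)\iff\gamma\in\partial\varphi(u)\iff u=\arg\min_{w\in U}\{\varphi(w)-\langle\gamma,w\rangle\}$. (a3) There are $u_0\in U$, $\gamma_0\in\partial\varphi(u_0)$, $\epsilon>0$ and a solution $u^*\in D(\varphi)$ of $F(u)=v$ with $\mathcal D_{\gamma_0}\varphi(u^*,u_0)\le c_0\epsilon^p$, and $B(u_0,3\epsilon)\subset D(F)$. (a4) There is $\mathcal C>0$ with $\mathcal D_\gamma\varphi(\tilde u,u)\le\mathcal C\|F(\tilde u)-F(u)\|^p$ for all $u,\tilde u\in B(u_0,3\epsilon)$, $\gamma\in\partial\varphi(u)$. (a5) There are bounded linear operators $L(u):U\to V$, $u\in B(u_0,3\epsilon)\cap D(\varphi)$, with $u\mapsto L(u)$ continuous there, and $0\le\eta<1$ such that $\|F(\tilde u)-F(u)-L(u)(\tilde u-u)\|\le\eta\|F(\tilde u)-F(u)\|$ for all $u,\tilde u\in B(u_0,3\epsilon)\cap D(\varphi)$. (a6) There is $C_0>0$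 with $\|L(u)\|\le C_0$ for all $u\in B(u_0,3\epsilon)\cap D(\varphi)$. Noisy iteration. Let $\tau>1$. Start with $u_{-1}^\delta=u_0^\delta=u_0$, $\gamma_{-1}^\delta=\gamma_0^\delta=\gamma_0$ (as in (a3)). For $k\ge0$, $$\Im_k^\delta=\gamma_k^\delta+\lambda_k^\delta(\gamma_k^\delta-\gamma_{k-1}^\delta),\quad w_k^\delta=\nabla\varphi^*(\Im_k^\delta),\quad \gamma_{k+1}^\delta=(1-\alpha_k)\Im_k^\delta-\upsilon_k^\delta L(w_k^\delta)^*J_s^V(r_k^\delta)+\alpha_k\Im_0,\quad u_{k+1}^\delta=\nabla\varphi^*(\gamma_{k+1}^\delta),$$ with $r_k^\delta=F(w_k^\delta)-v^\delta$, $\Im_0=\Im_0^\delta=\gamma_0$, $t_k^\delta=\|\Im_k^\delta-\Im_0\|$, $\lambda_k^\delta\ge0$, $\alpha_k\in[0,1]$. The step size is $$\upsilon_k^\delta=\min\left\{\frac{\frac12\big(\vartheta_1^{p^*-1}\|r_k^\delta\|^s-\vartheta_{2,k}(t_k^\delta)^{p^*}\big)^{\frac1{p^*-1}}}{\|L(w_k^\delta)^*J_s^V(r_k^\delta)\|^p},\ \vartheta_3\|r_k^\delta\|^{p-s}\right\}\ \text{if } \|r_k^\delta\|>\tau\delta,\qquad \upsilon_k^\delta=0\ \text{if }\|r_k^\delta\|\le\tau\delta$$ (the quotient being read as $+\infty$ if its denominator is $0$). Here $\vartheta_1,\bar\vartheta_2,\vartheta_3>0$ are constants and the positive numbers $\vartheta_{2,k}$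 are chosen such that, for every $k$ with $\|r_k^\delta\|>\tau\delta$, $\vartheta_{2,k}(t_k^\delta)^{p^*}\le\bar\vartheta_2^{\,p^*-1}\|r_k^\delta\|^s\le\vartheta_1^{p^*-1}\|r_k^\delta\|^s$ and $\vartheta_1^{p^*-1}\|r_k^\delta\|^s-\vartheta_{2,k}(t_k^\delta)^{p^*}>0$. For a positive constant $\vartheta_4$, whenever $\upsilon_k^\delta\ne0$ and $t_k^\delta\ne0$, $$\alpha_k\le\min\Big\{\vartheta_4\upsilon_k^\delta\|F(w_k^\delta)-v^\delta\|^{s-1}(t_k^\delta)^{-1},\ 2^{\frac{1-p^*}{p^*}}(\vartheta_{2,k}\upsilon_k^\delta)^{\frac1{p^*}}\Big\};$$ if $\upsilon_k^\delta=0$, $\alpha_k$ may be arbitrary in $[0,1]$. Exact-data iteration. This is the same scheme with $\delta=0$, $v^\delta=v$ and all superscripts $\delta$ omitted; thus $\upsilon_k$ is given by the min-formula if $r_k=F(w_k)-v\neq0$ and $\upsilon_k=0$ if $r_k=0$. As the notation indicates, $\alpha_k$ and $\vartheta_{2,k}$ do not depend on $\delta$. *)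

theory Defs
  imports "HOL-Analysis.Analysis"
begin

section \<open>Banach space notions\<close>

type_synonym 'a dual = "'a \<Rightarrow>\<^sub>L real"

definition reflexive_space :: "'a::real_normed_vector itself \<Rightarrow> bool" where
  "reflexive_space _ \<longleftrightarrow> (\<forall>\<Phi> :: 'a dual dual. \<exists>x::'a. \<forall>f :: 'a dual. blinfun_apply \<Phi> f = blinfun_apply f x)"

definition uniformly_smooth :: "'a::real_normed_vector itself \<Rightarrow> bool" where
  "uniformly_smooth _ \<longleftrightarrow>
     (\<forall>e>0. \<exists>d>0. \<forall>x y :: 'a. norm x = 1 \<and> norm y \<le> d \<longrightarrow>
        norm (x + y) + norm (x - y) \<le> 2 + e * norm y)"

definition weakly_converges :: "(nat \<Rightarrow> 'a::real_normed_vector) \<Rightarrow> 'a \<Rightarrow> bool" where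
  "weakly_converges x l \<longleftrightarrow> (\<forall>f :: 'a dual. (\<lambda>n. blinfun_apply f (x n)) \<longlonglongrightarrow> blinfun_apply f l)"

text \<open>Weak closedness and weak lower semicontinuity are understood sequentially.\<close>

definition weakly_closed_on ::
    "'a::real_normed_vector set \<Rightarrow> ('a \<Rightarrow> 'b::real_normed_vector) \<Rightarrow> bool" where
  "weakly_closed_on D F \<longleftrightarrow>
     (\<forall>x l y. (\<forall>n. x n \<in> D) \<and> weakly_converges x l \<and> weakly_converges (\<lambda>n. F (x n)) y
        \<longrightarrow> l \<in> D \<and> F l = y)"

definition weakly_lsc :: "('a::real_normed_vector \<Rightarrow> ereal) \<Rightarrow> bool" where
  "weakly_lsc \<phi> \<longleftrightarrow>
     (\<forall>x l. weakly_converges x l \<longrightarrow> \<phi> l \<le> liminf (\<lambda>n. \<phi> (x n)))"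

definition dual_map ::
    "('a::real_normed_vector \<Rightarrow>\<^sub>L 'b::real_normed_vector) \<Rightarrow> 'b dual \<Rightarrow> 'a dual" where
  "dual_map A j = j o\<^sub>L A"

text \<open>The duality mapping with gauge \<open>t \<mapsto> t powr (s - 1)\<close>. The description is meaningful because
  the functional is unique when the space is (uniformly) smooth.\<close>

definition duality_mapping :: "real \<Rightarrow> 'a::real_normed_vector \<Rightarrow> 'a dual" where
  "duality_mapping s x =
     (THE j. norm j = norm x powr (s - 1) \<and> blinfun_apply j x = norm x powr s)"


section \<open>Convex analysis\<close>

definition eff_dom :: "('a \<Rightarrow> ereal) \<Rightarrow> 'a set" where
  "eff_dom \<phi> = {u. \<phi> u < \<infinity>}"

definition proper_fun :: "('a \<Rightarrow> ereal) \<Rightarrow> bool" where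
  "proper_fun \<phi> \<longleftrightarrow> (\<forall>u. \<phi> u \<noteq> -\<infinity>) \<and> eff_dom \<phi> \<noteq> {}"

definition p_convex :: "real \<Rightarrow> real \<Rightarrow> ('a::real_normed_vector \<Rightarrow> ereal) \<Rightarrow> bool" where
  "p_convex p c \<phi> \<longleftrightarrow>
     (\<forall>u u'. \<forall>t\<in>{0..1}.
        \<phi> (t *\<^sub>R u' + (1 - t) *\<^sub>R u) + ereal (t * (1 - t) * c * norm (u - u') powr p)
          \<le> ereal t * \<phi> u' + ereal (1 - t) * \<phi> u)"

definition subdifferential :: "('a::real_normed_vector \<Rightarrow> ereal) \<Rightarrow> 'a \<Rightarrow> 'a dual set" where
  "subdifferential \<phi> u = {\<gamma>. \<forall>w. \<phi> u + ereal (blinfun_apply \<gamma> (w - u)) \<le> \<phi> w}"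

definition dom_subdifferential :: "('a::real_normed_vector \<Rightarrow> ereal) \<Rightarrow> 'a set" where
  "dom_subdifferential \<phi> = {u \<in> eff_dom \<phi>. subdifferential \<phi> u \<noteq> {}}"

definition conjugate :: "('a::real_normed_vector \<Rightarrow> ereal) \<Rightarrow> 'a dual \<Rightarrow> ereal" where
  "conjugate \<phi> \<gamma> = (SUP u. ereal (blinfun_apply \<gamma> u) - \<phi> u)"

text \<open>The Frechet gradient of the conjugate, as an element of the space itself: the derivative lies
  in the bidual, which is identified with the space (reflexivity) by evaluation at a point. The
  conversion to real values loses nothing for proper weakly lower semicontinuous \<open>p\<close>-convex
  functions, whose conjugates are finite everywhere.\<close>

definition grad_conjugate :: "('a::real_normed_vector \<Rightarrow> ereal) \<Rightarrow> 'a dual \<Rightarrow> 'a" where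
  "grad_conjugate \<phi> \<gamma> =
     (THE u. ((\<lambda>g. real_of_ereal (conjugate \<phi> g)) has_derivative (\<lambda>h. blinfun_apply h u)) (at \<gamma>))"

text \<open>\<open>bregman \<phi> \<gamma> u' u\<close> is the Bregman distance from \<open>u\<close> to \<open>u'\<close>, for \<open>\<gamma>\<close> in the
  subdifferential at \<open>u\<close>; it is infinite if \<open>u'\<close> lies outside the effective domain.\<close>

definition bregman :: "('a::real_normed_vector \<Rightarrow> ereal) \<Rightarrow> 'a dual \<Rightarrow> 'a \<Rightarrow> 'a \<Rightarrow> ereal" where
  "bregman \<phi> \<gamma> u' u = \<phi> u' - \<phi> u - ereal (blinfun_apply \<gamma> (u' - u))"


section \<open>The iteration\<close>

text \<open>\<open>prev a x k\<close> is the entry before \<open>x k\<close> of the sequence \<open>x\<close> preceded by \<open>x\<^sub>-\<^sub>1 = a\<close>.\<close>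

definition prev :: "'a \<Rightarrow> (nat \<Rightarrow> 'a) \<Rightarrow> nat \<Rightarrow> 'a" where
  "prev a x k = (case k of 0 \<Rightarrow> a | Suc j \<Rightarrow> x j)"

text \<open>Step size, where \<open>q\<close> is the exponent conjugate to \<open>p\<close>, \<open>\<rho>\<close> the norm of the residual, \<open>d\<close> the
  norm of the dual of the linearisation applied to the duality mapping of the residual, and \<open>t\<close> the
  distance of the extrapolated dual iterate from the initial one. Since \<open>x / 0 = 0\<close> in HOL, the
  case of a vanishing denominator (quotient \<open>+\<infinity>\<close>) is separated.\<close>

definition step_size ::
    "real \<Rightarrow> real \<Rightarrow> real \<Rightarrow> real \<Rightarrow> real \<Rightarrow> real \<Rightarrow> real \<Rightarrow> real \<Rightarrow> real \<Rightarrow> real \<Rightarrow> real \<Rightarrow> real" where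
  "step_size p q s \<theta>1 \<theta>2 \<theta>3 \<tau> \<delta> \<rho> d t =
     (if \<rho> > \<tau> * \<delta> then
        (if d = 0 then \<theta>3 * \<rho> powr (p - s)
         else min ((1/2) * (\<theta>1 powr (q - 1) * \<rho> powr s - \<theta>2 * t powr q) powr (1 / (q - 1)) / d powr p)
                  (\<theta>3 * \<rho> powr (p - s)))
      else 0)"

end

theory Submission
  imports Defs
begin

text \<open>By the stability estimate \<open>a4\<close>, every point of the ball \<open>B(u\<^sub>0, 3\<epsilon>)\<close> with a small residual is
  Bregman-close to the given solution \<open>u\<^sup>*\<close>, and the discrepancy principle makes the residual at the
  stopping index at most \<open>(\<tau> + 1)\<delta>\<close>. There the step size vanishes, so the extrapolation is trivial
  and \<open>w\<close> agrees with \<open>u\<close>. Hence \<open>u\<^sup>*\<close> itself is the limit, once the iterates are known to stay in the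
  ball; this follows from the monotonicity of the Bregman distance to \<open>u\<^sup>*\<close> before stopping.\<close>

section \<open>The duality mapping of a uniformly smooth space\<close>

text \<open>Descent and localisation cannot be proved one after the other: a step is controlled only
  if the extrapolated point lies in \<open>cball u0 (3 * \<epsilon>)\<close>, where a4 and a5 apply,
  while extrapolation may itself increase the distance to the solution. A single induction carries
  both. The two bounds on the extrapolation parameters serve its two halves: one keeps the point in
  the ball, the other is paid for by the decrease in the step that follows. Distances are treated as
  functions of the dual variable. For fixed \<open>y\<close> they are the conjugate plus an affine
  term, and p-convexity makes the conjugate smooth of order \<open>q\<close>; the constant
  \<open>q * (2 * c0) powr (q - 1)\<close> comes from integrating the Hoelder estimate for its
  gradient. Both \<open>duality_mapping\<close> and \<open>grad_conjugate\<close> are definite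
  descriptions, so existence and uniqueness must be settled before either can be used. The result is
  quantitative: the distance at the stopping index is at most
  \<open>C * ((\<tau> + 1) * \<delta>) powr p\<close>.\<close>

text \<open>The functional is the directional derivative of the norm, which smoothness makes linear; this
  replaces the Hahn-Banach theorem.\<close>

lemma support_functional:
  fixes x :: "'a::real_normed_vector"
  assumes smooth: "uniformly_smooth TYPE('a)" and x: "norm x = 1"
  obtains j :: "'a dual" where "norm j = 1" "j x = 1"
proof -
  define h where "h t y = (norm (x + t *\<^sub>R y) - 1) / t" for t and y :: 'a
  define N where "N y = (INF t\<in>{0<..}. h t y)" for y
  have h_ge: "- norm y \<le> h t y" if "t > 0" for t y
  proof -
    have "norm x - norm (t *\<^sub>R y) \<le> norm (x + t *\<^sub>R y)"
      by (metis add.commute add_diff_cancel_left' diff_le_eq norm_triangle_ineq4)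
    then show ?thesis using that x by (simp add: h_def field_simps)
  qed
  have h_le: "h t y \<le> norm y" if "t > 0" for t y
  proof -
    have "norm (x + t *\<^sub>R y) \<le> norm x + t * norm y"
      using norm_triangle_ineq[of x "t *\<^sub>R y"] that by simp
    then show ?thesis using that x by (simp add: h_def field_simps)
  qed
  have bdd: "bdd_below ((\<lambda>t. h t y) ` {0<..})" for y
    by (rule bdd_belowI[of _ "- norm y"]) (auto simp: h_ge)
  have N_le: "N y \<le> h t y" if "t > 0" for t y
    unfolding N_def using that bdd by (intro cINF_lower) auto
  have N_ge: "b \<le> N y" if "\<And>t. t > 0 \<Longrightarrow> b \<le> h t y" for b y
    unfolding N_def using that by (intro cINF_greatest) auto
  have N_less: "\<exists>t>0. h t y < b" if "N y < b" for b y
    using N_ge[of b y] that by (meson not_le)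
  \<comment> \<open>Convexity of the norm: \<open>x + r y\<close> lies on the segment from
    \<open>x\<close> to \<open>x + t y\<close>. Hence the infimum \<open>N\<close> is the one-sided
    limit, and quotients may be compared at a common smaller step.\<close>
  have h_mono: "h r y \<le> h t y" if "0 < r" "r \<le> t" for r t y
  proof -
    have "x + r *\<^sub>R y = (1 - r/t) *\<^sub>R x + (r/t) *\<^sub>R (x + t *\<^sub>R y)"
      using that by (simp add: algebra_simps)
    then have "norm (x + r *\<^sub>R y) \<le> (1 - r/t) * norm x + (r/t) * norm (x + t *\<^sub>R y)"
      using norm_triangle_ineq[of "(1 - r/t) *\<^sub>R x" "(r/t) *\<^sub>R (x + t *\<^sub>R y)"] that by simp
    then have "norm (x + r *\<^sub>R y) - 1 \<le> (r/t) * (norm (x + t *\<^sub>R y) - 1)"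
      using x by (simp add: algebra_simps)
    then have "r * ((norm (x + r *\<^sub>R y) - 1) / r) \<le> r * ((norm (x + t *\<^sub>R y) - 1) / t)"
      using that by simp
    then show ?thesis using that unfolding h_def by (rule_tac mult_left_le_imp_le)
  qed
  have sub: "N (y + z) \<le> N y + N z" for y z
  proof (rule field_le_epsilon)
    fix e :: real assume "e > 0"
    then obtain r t where rt: "r > 0" "h r y < N y + e/2" "t > 0" "h t z < N z + e/2"
      using N_less[of y "N y + e/2"] N_less[of z "N z + e/2"] by auto
    \<comment> \<open>The halving makes \<open>x + a (y + z)\<close> the midpoint of
      \<open>x + 2a y\<close> and \<open>x + 2a z\<close>, whose steps \<open>2a\<close> are still
      at most \<open>r\<close> and \<open>t\<close>.\<close>
    define a where "a = min r t / 2"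
    have a: "a > 0" "2*a \<le> r" "2*a \<le> t" using rt by (auto simp: a_def)
    have "2 *\<^sub>R (x + a *\<^sub>R (y + z)) = (x + (2*a) *\<^sub>R y) + (x + (2*a) *\<^sub>R z)"
      by (simp add: algebra_simps scaleR_2)
    then have "2 * norm (x + a *\<^sub>R (y + z)) \<le> norm (x + (2*a) *\<^sub>R y) + norm (x + (2*a) *\<^sub>R z)"
      using norm_triangle_ineq[of "x + (2*a) *\<^sub>R y" "x + (2*a) *\<^sub>R z"]
      by (metis abs_numeral norm_scaleR)
    then have "h a (y + z) \<le> h (2*a) y + h (2*a) z"
      using a divide_right_mono[of "2 * norm (x + a *\<^sub>R (y + z))"
          "norm (x + (2*a) *\<^sub>R y) + norm (x + (2*a) *\<^sub>R z)" "2 * a"]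
      by (simp add: h_def diff_divide_distrib add_divide_distrib)
    also have "\<dots> \<le> h r y + h t z" using a h_mono[of "2*a" r y] h_mono[of "2*a" t z] by simp
    finally show "N (y + z) \<le> N y + N z + e" using N_le[of a "y+z"] a rt by simp
  qed
  \<comment> \<open>Subadditivity already gives the reverse inequality; smoothness is what turns the
    sublinear \<open>N\<close> into a linear one. The tolerance is taken as
    \<open>e / norm y\<close> so that the error after division by \<open>a\<close> is exactly
    \<open>e\<close>.\<close>
  have odd_le: "N y + N (- y) \<le> 0" for y
  proof (cases "y = 0")
    case True
    then show ?thesis using N_le[of 1 0] x by (simp add: h_def)
  next
    case False
    show ?thesis
    proof (rule field_le_epsilon)
      fix e :: real assume e: "e > 0"
      then have "e / norm y > 0" using False by simp
      then obtain d where d: "d > 0" and dd: "\<And>x z :: 'a. norm x = 1 \<Longrightarrow> norm z \<le> d \<Longrightarrow>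
          norm (x + z) + norm (x - z) \<le> 2 + e / norm y * norm z"
        using smooth unfolding uniformly_smooth_def by meson
      define a where "a = d / norm y"
      have a: "a > 0" "norm (a *\<^sub>R y) \<le> d" using d False by (auto simp: a_def)
      have "norm (x + a *\<^sub>R y) + norm (x - a *\<^sub>R y) \<le> 2 + e / norm y * norm (a *\<^sub>R y)"
        using dd[OF x a(2)] .
      then have "(norm (x + a *\<^sub>R y) - 1 + (norm (x - a *\<^sub>R y) - 1)) / a \<le> a * e / a"
        using a False by (intro divide_right_mono) (auto simp: mult.commute)
      then have "h a y + h a (- y) \<le> e"
        using a(1) by (simp add: h_def add_divide_distrib diff_divide_distrib)
      then show "N y + N (- y) \<le> 0 + e" using N_le[of a y] N_le[of a "-y"] a by simp
    qed
  qed
  have N0: "N 0 = 0" using sub[of 0 0] odd_le[of 0] by simp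
  have odd: "N (- y) = - N y" for y
    using odd_le[of y] sub[of y "-y"] N0 by simp
  have add: "N (y + z) = N y + N z" for y z
    using sub[of y z] sub[of "-y" "-z"] odd[of y] odd[of z] odd[of "y+z"] by simp
  have scale_le: "N (c *\<^sub>R y) \<le> c * N y" if "c > 0" for c y
  proof -
    have "N (c *\<^sub>R y) / c \<le> h t y" if "t > 0" for t
    proof -
      have "N (c *\<^sub>R y) \<le> h (t / c) (c *\<^sub>R y)" using \<open>c > 0\<close> that by (intro N_le) simp
      also have "\<dots> = c * h t y" using \<open>c > 0\<close> that by (simp add: h_def)
      finally show ?thesis using \<open>c > 0\<close> by (simp add: field_simps)
    qed
    then have "N (c *\<^sub>R y) / c \<le> N y" by (rule N_ge)
    then show ?thesis using that by (simp add: field_simps)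
  qed
  have scale_pos: "N (c *\<^sub>R y) = c * N y" if "c > 0" for c y
    using scale_le[OF that, of y] scale_le[of "1/c" "c *\<^sub>R y"] that by (simp add: field_simps)
  have scale: "N (c *\<^sub>R y) = c * N y" for c y
    using scale_pos[of c y] scale_pos[of "-c" y] odd[of "c *\<^sub>R y"] N0
    by (cases c "0::real" rule: linorder_cases) auto
  have bound: "\<bar>N y\<bar> \<le> norm y" for y
    using N_le[of 1 y] h_le[of 1 y] N_le[of 1 "-y"] h_le[of 1 "-y"] odd[of y] by simp
  have "bounded_linear N"
    by (rule bounded_linear_intro[where K=1]) (auto simp: add scale bound)
  then have apply_N: "Blinfun N y = N y" for y by (simp add: bounded_linear_Blinfun_apply)
  have "h t x = 1" if "t > 0" for t
  proof -
    have "x + t *\<^sub>R x = (1 + t) *\<^sub>R x" by (simp add: algebra_simps)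
    then show ?thesis using that x by (simp add: h_def)
  qed
  then have Nx: "N x = 1" using N_le[of 1 x] N_ge[of 1 x] by simp
  have "norm (Blinfun N) \<le> 1" by (rule norm_blinfun_bound) (auto simp: apply_N bound)
  moreover have "1 \<le> norm (Blinfun N)"
    using norm_blinfun[of "Blinfun N" x] by (simp add: apply_N Nx x)
  ultimately show thesis using that[of "Blinfun N"] by (simp add: apply_N Nx)
qed

text \<open>Adding \<open>j (x + a y)\<close> and \<open>j' (x - a y)\<close> gives
  \<open>2 + a (j y - j' y)\<close>, which smoothness bounds by \<open>2 + a e\<close>. Applying
  this to \<open>y\<close> and \<open>-y\<close> leaves no room for a difference.\<close>

lemma support_functional_unique:
  fixes x :: "'a::real_normed_vector" and j j' :: "'a dual"
  assumes smooth: "uniformly_smooth TYPE('a)" and x: "norm x = 1"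
    and j: "norm j \<le> 1" "j x = 1" and j': "norm j' \<le> 1" "j' x = 1"
  shows "j = j'"
proof -
  have le: "f y \<le> norm y" if "norm f \<le> 1" for f :: "'a dual" and y
  proof -
    have "f y \<le> norm f * norm y" using norm_blinfun[of f y] by simp
    also have "\<dots> \<le> norm y" using mult_right_mono[OF that norm_ge_zero[of y]] by simp
    finally show ?thesis .
  qed
  have key: "j y - j' y \<le> 0" for y
  proof (cases "y = 0")
    case False
    show ?thesis
    proof (rule field_le_epsilon)
      fix e :: real assume e: "e > 0"
      then have "e / norm y > 0" using False by simp
      then obtain d where d: "d > 0" and dd: "\<And>x z :: 'a. norm x = 1 \<Longrightarrow> norm z \<le> d \<Longrightarrow>
          norm (x + z) + norm (x - z) \<le> 2 + e / norm y * norm z"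
        using smooth unfolding uniformly_smooth_def by meson
      define a where "a = d / norm y"
      have a: "a > 0" "norm (a *\<^sub>R y) \<le> d" using d False by (auto simp: a_def)
      have "j (x + a *\<^sub>R y) + j' (x - a *\<^sub>R y) \<le> 2 + e / norm y * norm (a *\<^sub>R y)"
        using dd[OF x a(2)] le[OF j(1), of "x + a *\<^sub>R y"] le[OF j'(1), of "x - a *\<^sub>R y"] by linarith
      then have "a * (j y - j' y) \<le> a * e" using a False j j'
        by (simp add: blinfun.add_right blinfun.diff_right blinfun.scaleR_right algebra_simps)
      then show "j y - j' y \<le> 0 + e" using a(1) by simp
    qed
  qed simp
  show ?thesis
  proof (rule blinfun_eqI)
    show "j y = j' y" for y
      using key[of y] key[of "-y"] by (simp add: blinfun.minus_right)
  qed
qed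

text \<open>Normalising \<open>x\<close> and \<open>j\<close> reduces the description to the unit
  sphere, where the support functional exists and is unique; at \<open>x = 0\<close> only the zero
  functional qualifies.\<close>

lemma duality_mapping:
  fixes x :: "'a::real_normed_vector"
  assumes smooth: "uniformly_smooth TYPE('a)" and s: "s > 1"
  shows norm_duality_mapping: "norm (duality_mapping s x) = norm x powr (s - 1)"
    and duality_mapping_self: "duality_mapping s x x = norm x powr s"
proof -
  have "\<exists>!j :: 'a dual. norm j = norm x powr (s - 1) \<and> blinfun_apply j x = norm x powr s"
  proof (cases "x = 0")
    case True
    then show ?thesis by auto
  next
    case False
    define c where "c = norm x powr (s - 1)"
    define y where "y = x /\<^sub>R norm x"
    have c: "c > 0" "norm x powr s = c * norm x" and y: "norm y = 1"
      using False by (auto simp: c_def y_def powr_mult_base powr_diff)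
    obtain j :: "'a dual" where j: "norm j = 1" "j y = 1"
      using support_functional[OF smooth y] by blast
    have jx: "f x = norm x * f y" for f :: "'a dual"
      using False by (simp add: y_def blinfun.scaleR_right)
    show ?thesis
    proof (rule ex1I[of _ "c *\<^sub>R j"])
      show "norm (c *\<^sub>R j) = norm x powr (s - 1) \<and> (c *\<^sub>R j) x = norm x powr s"
        using c j by (simp add: c_def[symmetric] jx blinfun.scaleR_left)
    next
      fix k :: "'a dual" assume k: "norm k = norm x powr (s - 1) \<and> k x = norm x powr s"
      have "k y = c" using k c False by (simp add: jx)
      then have "k /\<^sub>R c = j"
        using k c j by (intro support_functional_unique[OF smooth y]) (auto simp: c_def[symmetric] blinfun.scaleR_left)
      then show "k = c *\<^sub>R j" using c by auto
    qed
  qed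
  from theI'[OF this] show "norm (duality_mapping s x) = norm x powr (s - 1)"
    "duality_mapping s x x = norm x powr s"
    unfolding duality_mapping_def by blast+
qed

section \<open>Conjugates of uniformly convex functions\<close>

text \<open>Midpoint convexity of the power. It later separates the gradient part of a dual
  increment from its relaxation part; the factor \<open>2 powr (q - 1)\<close> is what the constants
  in the step size and in the bound on \<open>\<alpha>\<close> compensate.\<close>

lemma powr_add_le:
  fixes x y q :: real
  assumes "x \<ge> 0" "y \<ge> 0" "q \<ge> 1"
  shows "(x + y) powr q \<le> 2 powr (q - 1) * (x powr q + y powr q)"
proof (cases "x = 0 \<or> y = 0")
  case True
  have "1 * z \<le> 2 powr (q - 1) * z" if "z \<ge> 0" for z :: real
    using assms that by (intro mult_right_mono ge_one_powr_ge_zero) auto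
  from this[of "x powr q"] this[of "y powr q"] show ?thesis using True by auto
next
  case False
  have "convex_on {0<..} (\<lambda>x. x powr q)"
    using assms(3) by (rule powr_convex)
  then have "((x + y) / 2) powr q \<le> (x powr q + y powr q) / 2"
    using convex_onD[of "{0<..}" "\<lambda>x. x powr q" "1/2" x y] assms False
    by (simp add: add_divide_distrib)
  then have "2 powr q * ((x + y) / 2) powr q \<le> 2 powr q * ((x powr q + y powr q) / 2)"
    by (rule mult_left_mono) simp
  then show ?thesis using assms by (simp add: powr_divide powr_diff)
qed

text \<open>Isolates the convex analysis from the iteration. The last assumption supplies an affine
  minorant of \<open>\<phi>\<close>, from which coercivity is derived; a3 provides it through
  \<open>\<gamma>0\<close>.\<close>

locale strongly_convex_function =
  fixes \<phi> :: "'u::banach \<Rightarrow> ereal" and p q c0 :: real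
  assumes p_gt_1: "p > 1" and conjugate_exponents: "1/p + 1/q = 1"
    and proper: "proper_fun \<phi>" and lsc: "weakly_lsc \<phi>"
    and c0_pos: "c0 > 0" and convex: "p_convex p c0 \<phi>"
    and bregman_ge: "\<And>u' u g. u \<in> dom_subdifferential \<phi> \<Longrightarrow> g \<in> subdifferential \<phi> u \<Longrightarrow>
         bregman \<phi> g u' u \<ge> ereal (c0 * norm (u - u') powr p)"
    and subgradient_exists: "\<exists>g u. g \<in> subdifferential \<phi> u"
begin

abbreviation \<phi>r :: "'u \<Rightarrow> real" where "\<phi>r x \<equiv> real_of_ereal (\<phi> x)"
abbreviation conj_real :: "'u dual \<Rightarrow> real" where "conj_real g \<equiv> real_of_ereal (conjugate \<phi> g)"
abbreviation m :: "'u dual \<Rightarrow> 'u" where "m \<equiv> grad_conjugate \<phi>"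

lemma q_eq: "q = p / (p - 1)" and q_minus_1: "q - 1 = 1 / (p - 1)" and q_gt_1: "q > 1"
proof -
  have "q \<noteq> 0" using conjugate_exponents p_gt_1 by (intro notI) simp
  then have "q * (p - 1) = p" using conjugate_exponents p_gt_1 by (simp add: field_simps)
  then show q: "q = p / (p - 1)" using p_gt_1 by (simp add: field_simps)
  show "q - 1 = 1 / (p - 1)" "q > 1" using p_gt_1 unfolding q by (simp_all add: field_simps)
qed

section \<open>Subgradients in real-valued form\<close>

lemma not_MInf: "\<phi> x \<noteq> - \<infinity>"
  using proper by (auto simp: proper_fun_def)

lemma \<phi>_eq: "x \<in> eff_dom \<phi> \<Longrightarrow> \<phi> x = ereal (\<phi>r x)"
  using not_MInf[of x] by (cases "\<phi> x") (auto simp: eff_dom_def)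

text \<open>Properness provides a point with finite value, and the subgradient inequality at that
  point excludes an infinite value at \<open>x\<close>; after this, real arithmetic
  suffices.\<close>

lemma subdifferential_iff:
  "g \<in> subdifferential \<phi> x \<longleftrightarrow> x \<in> eff_dom \<phi> \<and> (\<forall>y\<in>eff_dom \<phi>. \<phi>r x + g (y - x) \<le> \<phi>r y)"
proof safe
  assume g: "g \<in> subdifferential \<phi> x"
  obtain y where y: "y \<in> eff_dom \<phi>" using proper by (auto simp: proper_fun_def)
  have "\<phi> x + ereal (g (y - x)) \<le> \<phi> y" using g by (auto simp: subdifferential_def)
  then show x: "x \<in> eff_dom \<phi>" using y by (auto simp: eff_dom_def)
  fix z assume z: "z \<in> eff_dom \<phi>"
  have "\<phi> x + ereal (g (z - x)) \<le> \<phi> z" using g by (auto simp: subdifferential_def)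
  then show "\<phi>r x + g (z - x) \<le> \<phi>r z" using \<phi>_eq[OF x] \<phi>_eq[OF z]
    by (metis ereal_less_eq(3) plus_ereal.simps(1))
next
  assume x: "x \<in> eff_dom \<phi>" and *: "\<forall>y\<in>eff_dom \<phi>. \<phi>r x + g (y - x) \<le> \<phi>r y"
  have "\<phi> x + ereal (g (z - x)) \<le> \<phi> z" for z
  proof (cases "z \<in> eff_dom \<phi>")
    case True
    then show ?thesis using * \<phi>_eq[OF x] \<phi>_eq[OF True]
      by (metis ereal_less_eq(3) plus_ereal.simps(1))
  qed (simp add: eff_dom_def)
  then show "g \<in> subdifferential \<phi> x" by (auto simp: subdifferential_def)
qed

lemma subgradient_dom: "g \<in> subdifferential \<phi> x \<Longrightarrow> x \<in> eff_dom \<phi>"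
  by (simp add: subdifferential_iff)

lemma bregman_eq:
  assumes "x \<in> eff_dom \<phi>" "y \<in> eff_dom \<phi>"
  shows "bregman \<phi> g y x = ereal (\<phi>r y - \<phi>r x - g (y - x))"
proof -
  obtain a b where "\<phi> x = ereal a" "\<phi> y = ereal b" using \<phi>_eq assms by blast
  then show ?thesis by (simp add: bregman_def)
qed

lemma subgradient_lower:
  assumes "g \<in> subdifferential \<phi> x" "y \<in> eff_dom \<phi>"
  shows "\<phi>r x + g (y - x) + c0 * norm (y - x) powr p \<le> \<phi>r y"
proof -
  have "x \<in> dom_subdifferential \<phi>" using assms subgradient_dom by (auto simp: dom_subdifferential_def)
  from bregman_ge[OF this assms(1), of y] show ?thesis
    using bregman_eq[of x y g] assms subgradient_dom by (auto simp: norm_minus_commute)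
qed

lemma subgradient_monotone:
  assumes "g \<in> subdifferential \<phi> x" "h \<in> subdifferential \<phi> y"
  shows "2 * c0 * norm (x - y) powr p \<le> (g - h) (x - y)"
  using subgradient_lower[OF assms(1) subgradient_dom[OF assms(2)]]
    subgradient_lower[OF assms(2) subgradient_dom[OF assms(1)]]
  by (simp add: blinfun.diff_left blinfun.diff_right norm_minus_commute algebra_simps)

text \<open>Cancelling one factor \<open>norm (x - y)\<close> from strong monotonicity leaves the
  power \<open>p - 1\<close>, which \<open>q - 1 = 1 / (p - 1)\<close> inverts. The case
  \<open>g = h\<close> gives uniqueness of the base point; the general case gives the modulus of the
  gradient of the conjugate.\<close>

lemma subgradient_Hoelder:
  assumes "g \<in> subdifferential \<phi> x" "h \<in> subdifferential \<phi> y"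
  shows "norm (x - y) \<le> (norm (g - h) / (2 * c0)) powr (q - 1)"
proof (cases "x = y")
  case False
  have "2 * c0 * norm (x - y) powr (p - 1) * norm (x - y) = 2 * c0 * norm (x - y) powr p"
    using False by (simp add: powr_diff)
  also have "\<dots> \<le> (g - h) (x - y)" by (rule subgradient_monotone[OF assms])
  also have "\<dots> \<le> norm (g - h) * norm (x - y)" using norm_blinfun[of "g - h" "x - y"] by simp
  finally have "2 * c0 * norm (x - y) powr (p - 1) \<le> norm (g - h)"
    using False by (simp only: mult_le_cancel_right) auto
  then have "norm (x - y) powr (p - 1) \<le> norm (g - h) / (2 * c0)"
    using c0_pos by (simp add: field_simps)
  then have "(norm (x - y) powr (p - 1)) powr (q - 1) \<le> (norm (g - h) / (2 * c0)) powr (q - 1)"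
    using q_gt_1 by (intro powr_mono2) auto
  then show ?thesis using p_gt_1 by (simp add: powr_powr q_minus_1)
qed simp

lemma subgradient_unique:
  assumes "g \<in> subdifferential \<phi> x" "g \<in> subdifferential \<phi> y"
  shows "x = y"
  using subgradient_Hoelder[OF assms] by simp

section \<open>Attainment of the minimum of tilted functionals\<close>

lemma midpoint_convex:
  assumes x: "x \<in> eff_dom \<phi>" and y: "y \<in> eff_dom \<phi>"
  defines "z \<equiv> (1/2) *\<^sub>R y + (1/2) *\<^sub>R x"
  shows "z \<in> eff_dom \<phi>" "\<phi>r z + c0 / 4 * norm (x - y) powr p \<le> (\<phi>r x + \<phi>r y) / 2"
proof -
  obtain a b where ab: "\<phi> x = ereal a" "\<phi> y = ereal b" using \<phi>_eq x y by blast
  then have *: "\<phi> z + ereal (c0 / 4 * norm (x - y) powr p) \<le> ereal ((\<phi>r x + \<phi>r y) / 2)"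
    using convex[unfolded p_convex_def, rule_format, of "1/2" y x]
    by (simp add: z_def ab add_divide_distrib add.commute)
  then show z: "z \<in> eff_dom \<phi>" by (auto simp: eff_dom_def)
  show "\<phi>r z + c0 / 4 * norm (x - y) powr p \<le> (\<phi>r x + \<phi>r y) / 2"
    using * \<phi>_eq[OF z] by (metis ereal_less_eq(3) plus_ereal.simps(1))
qed

text \<open>Replacing \<open>g0\<close> by \<open>g\<close> costs at most
  \<open>norm (g - g0) * R\<close> at distance \<open>R\<close> from \<open>u0\<close>, and the
  Bregman growth \<open>c0 * R powr p\<close> with \<open>p > 1\<close> outweighs this far
  away.\<close>

lemma tilted_bounded_below:
  "\<exists>b. \<forall>x\<in>eff_dom \<phi>. b \<le> \<phi>r x - blinfun_apply g x"
proof -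
  obtain g0 u0 where g0: "g0 \<in> subdifferential \<phi> u0" using subgradient_exists by auto
  \<comment> \<open>The radius at which \<open>c0 * R powr (p - 1)\<close> reaches
    \<open>norm (g - g0)\<close>: inside it the loss is bounded, outside it the growth
    dominates.\<close>
  define a where "a = (norm (g - g0) / c0) powr (1 / (p - 1))"
  have "\<phi>r u0 - g u0 - norm (g - g0) * a \<le> \<phi>r x - g x" if x: "x \<in> eff_dom \<phi>" for x
  proof -
    define R where "R = norm (x - u0)"
    have "norm (g - g0) * R - norm (g - g0) * a \<le> c0 * R powr p"
    proof (cases "R \<le> a")
      case True
      then have "norm (g - g0) * R \<le> norm (g - g0) * a" by (simp add: mult_left_mono)
      moreover have "0 \<le> c0 * R powr p" using c0_pos by simp
      ultimately show ?thesis by linarith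
    next
      case False
      have "a \<ge> 0" by (simp add: a_def)
      then have R: "R > 0" using False by linarith
      have "norm (g - g0) / c0 = a powr (p - 1)" using p_gt_1 c0_pos by (simp add: a_def powr_powr)
      also have "\<dots> \<le> R powr (p - 1)" using False p_gt_1 \<open>a \<ge> 0\<close> by (intro powr_mono2) auto
      finally have "norm (g - g0) \<le> c0 * R powr (p - 1)" using c0_pos by (simp add: field_simps)
      then have "norm (g - g0) * R \<le> c0 * R powr (p - 1) * R" using R by (intro mult_right_mono) auto
      also have "\<dots> = c0 * R powr p" using R by (simp add: powr_diff)
      finally show ?thesis using mult_nonneg_nonneg[OF norm_ge_zero[of "g - g0"] \<open>a \<ge> 0\<close>] by linarith
    qed
    moreover have "(g - g0) (x - u0) \<le> norm (g - g0) * R"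
      using norm_blinfun[of "g - g0" "x - u0"] by (simp add: R_def)
    moreover have "\<phi>r u0 + g0 (x - u0) + c0 * R powr p \<le> \<phi>r x"
      using subgradient_lower[OF g0 x] by (simp add: R_def)
    ultimately show ?thesis by (simp add: blinfun.diff_left blinfun.diff_right)
  qed
  then show ?thesis by blast
qed

text \<open>By \<open>p\<close>-convexity minimising sequences of the tilted functional are Cauchy, which replaces
  weak compactness.\<close>

lemma subgradient_surjective: "\<exists>x. g \<in> subdifferential \<phi> x"
proof -
  define f where "f x = \<phi>r x - g x" for x
  define I where "I = (INF x\<in>eff_dom \<phi>. f x)"
  have ne: "eff_dom \<phi> \<noteq> {}" using proper by (auto simp: proper_fun_def)
  have bdd: "bdd_below (f ` eff_dom \<phi>)"
    using tilted_bounded_below[of g] by (auto simp: f_def bdd_below_def)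
  have I_le: "I \<le> f x" if "x \<in> eff_dom \<phi>" for x
    unfolding I_def using that bdd by (intro cINF_lower) auto
  have "\<exists>x\<in>eff_dom \<phi>. f x < I + 1 / real (Suc n)" for n
    using cINF_less_iff[OF ne bdd, of "I + 1 / real (Suc n)"] by (simp add: I_def)
  then obtain X where X: "\<And>n. X n \<in> eff_dom \<phi>" "\<And>n. f (X n) < I + 1 / real (Suc n)" by metis
  have f_lim: "(\<lambda>n. f (X n)) \<longlonglongrightarrow> I"
  proof (rule tendsto_sandwich[where f = "\<lambda>_. I" and h = "\<lambda>n. I + 1 / real (Suc n)"])
    show "(\<lambda>n. I + 1 / real (Suc n)) \<longlonglongrightarrow> I"
      using tendsto_add[OF tendsto_const LIMSEQ_inverse_real_of_nat, of I] by (simp add: divide_inverse)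
    show "\<forall>\<^sub>F n in sequentially. f (X n) \<le> I + 1 / real (Suc n)"
      using X(2) less_imp_le by (intro always_eventually) blast
  qed (auto intro!: always_eventually I_le X(1))
  \<comment> \<open>Both points are almost minimal and their midpoint cannot go below
    \<open>I\<close>, so the convexity gap at the midpoint is at most the excess over
    \<open>I\<close>.\<close>
  have close: "norm (X i - X j) powr p \<le> 4 / c0 / real (Suc n)" if "n \<le> i" "n \<le> j" for i j n
  proof -
    define B where "B = c0 / 4 * norm (X i - X j) powr p"
    define z where "z = (1/2) *\<^sub>R X j + (1/2) *\<^sub>R X i"
    note z = midpoint_convex[OF X(1) X(1), of j i, folded z_def]
    have "I \<le> f z" using I_le z(1) by simp
    moreover have "2 * (f z + B) \<le> f (X i) + f (X j)"
      using z(2) by (simp add: f_def z_def B_def blinfun.add_right blinfun.scaleR_right add_divide_distrib diff_divide_distrib)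
    moreover have X_le: "f (X k) \<le> I + 1 / real (Suc n)" if "n \<le> k" for k
    proof -
      have "1 / real (Suc k) \<le> 1 / real (Suc n)" using that by (simp add: frac_le)
      then show ?thesis using X(2)[of k] by linarith
    qed
    ultimately have "2 * (I + B) \<le> 2 * (I + 1 / real (Suc n))"
      using X_le[OF that(1)] X_le[OF that(2)] unfolding distrib_left by linarith
    then have "B \<le> 1 / real (Suc n)" by simp
    from mult_left_mono[OF this, of "4 / c0"] show ?thesis using c0_pos by (simp add: B_def)
  qed
  have "Cauchy X"
  proof (rule metric_CauchyI)
    fix e :: real assume e: "e > 0"
    have "(\<lambda>n. 4 / c0 / real (Suc n)) \<longlonglongrightarrow> 0"
      using tendsto_mult[OF tendsto_const LIMSEQ_inverse_real_of_nat, of "4 / c0"] by (simp add: divide_inverse)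
    then have "eventually (\<lambda>n. 4 / c0 / real (Suc n) < e powr p) sequentially"
      using e by (intro order_tendstoD) auto
    then obtain N where N: "4 / c0 / real (Suc N) < e powr p" by (auto simp: eventually_sequentially)
    have "dist (X i) (X j) < e" if "N \<le> i" "N \<le> j" for i j
    proof (rule ccontr)
      assume "\<not> dist (X i) (X j) < e"
      then have "e powr p \<le> norm (X i - X j) powr p"
        using e p_gt_1 by (intro powr_mono2) (auto simp: dist_norm)
      with close[OF that] N show False by linarith
    qed
    then show "\<exists>M. \<forall>m\<ge>M. \<forall>n\<ge>M. dist (X m) (X n) < e" by blast
  qed
  then obtain l where l: "X \<longlonglongrightarrow> l" by (auto simp: Cauchy_convergent_iff convergent_def)
  \<comment> \<open>Norm convergence is passed on as weak convergence, the form in which lower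
    semicontinuity is available; the taking \<open>h = g\<close> also recovers the limit of the
    values of \<open>\<phi>\<close> from that of \<open>f\<close>.\<close>
  have g_lim: "(\<lambda>n. blinfun_apply h (X n)) \<longlonglongrightarrow> blinfun_apply h l" for h :: "'u dual"
    by (rule tendsto_intros l)+
  then have "weakly_converges X l" by (auto simp: weakly_converges_def)
  then have "\<phi> l \<le> liminf (\<lambda>n. \<phi> (X n))" using lsc by (auto simp: weakly_lsc_def)
  also have "liminf (\<lambda>n. \<phi> (X n)) = ereal (I + g l)"
  proof (rule lim_imp_Liminf)
    have "(\<lambda>n. f (X n) + g (X n)) \<longlonglongrightarrow> I + g l" by (intro tendsto_add f_lim g_lim)
    moreover have "\<phi> (X n) = ereal (f (X n) + g (X n))" for n
      using \<phi>_eq[OF X(1)] by (simp add: f_def)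
    ultimately show "(\<lambda>n. \<phi> (X n)) \<longlonglongrightarrow> ereal (I + g l)" by simp
  qed simp
  finally have le: "\<phi> l \<le> ereal (I + g l)" .
  then have l_dom: "l \<in> eff_dom \<phi>" by (auto simp: eff_dom_def)
  obtain a where a: "\<phi> l = ereal a" using \<phi>_eq[OF l_dom] by blast
  then have "f l \<le> I" using le by (simp add: f_def)
  have "\<phi>r l + g (y - l) \<le> \<phi>r y" if "y \<in> eff_dom \<phi>" for y
    using \<open>f l \<le> I\<close> I_le[OF that] by (simp add: f_def blinfun.diff_right)
  then have "g \<in> subdifferential \<phi> l" using l_dom by (simp add: subdifferential_iff)
  then show ?thesis ..
qed

section \<open>The conjugate and its gradient\<close>

lemma conjugate_eq:
  assumes "g \<in> subdifferential \<phi> x"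
  shows "conjugate \<phi> g = ereal (g x - \<phi>r x)"
  unfolding conjugate_def
proof (rule SUP_eqI)
  fix y
  show "ereal (g y) - \<phi> y \<le> ereal (g x - \<phi>r x)"
  proof (cases "y \<in> eff_dom \<phi>")
    case True
    obtain b where b: "\<phi> y = ereal b" using \<phi>_eq[OF True] by blast
    have "\<phi>r x + g (y - x) \<le> \<phi>r y" using assms True by (simp add: subdifferential_iff)
    then show ?thesis by (simp add: b blinfun.diff_right)
  qed (simp add: eff_dom_def)
next
  fix b assume "\<And>y. y \<in> UNIV \<Longrightarrow> ereal (g y) - \<phi> y \<le> b"
  then have *: "ereal (g x) - \<phi> x \<le> b" by simp
  obtain a where a: "\<phi> x = ereal a" using \<phi>_eq[OF subgradient_dom[OF assms]] by blast
  show "ereal (g x - \<phi>r x) \<le> b" using * by (simp add: a)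
qed

lemma conj_real_eq: "g \<in> subdifferential \<phi> x \<Longrightarrow> conj_real g = g x - \<phi>r x"
  by (simp add: conjugate_eq)

text \<open>The Young-Fenchel inequality for \<open>h\<close> at \<open>x\<close>, combined with
  Fenchel's equality for \<open>g\<close> at \<open>x\<close>; it makes \<open>x\<close> a
  subgradient of the conjugate at \<open>g\<close>.\<close>

lemma conj_real_subgradient:
  assumes g: "g \<in> subdifferential \<phi> x"
  shows "conj_real g + (h - g) x \<le> conj_real h"
proof -
  obtain y where y: "h \<in> subdifferential \<phi> y" using subgradient_surjective by auto
  have "\<phi>r y + h (x - y) \<le> \<phi>r x"
    using subgradient_dom[OF g] y by (simp add: subdifferential_iff)
  then show ?thesis
    by (simp add: conj_real_eq[OF g] conj_real_eq[OF y] blinfun.diff_left blinfun.diff_right)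
qed

text \<open>Subgradient inequalities at \<open>g\<close> and at \<open>h\<close> squeeze the
  remainder between zero and \<open>(h - g) (y - x)\<close>, which the Hoelder estimate makes of
  order \<open>norm (h - g) powr q\<close> with \<open>q > 1\<close>.\<close>

lemma conj_real_has_derivative:
  assumes g: "g \<in> subdifferential \<phi> x"
  shows "(conj_real has_derivative (\<lambda>h. h x)) (at g)"
  unfolding has_derivative_iff_norm
proof
  show "bounded_linear (\<lambda>h::'u dual. h x)" by (rule blinfun.bounded_linear_left)
  have "norm (conj_real h - conj_real g - (h - g) x) / norm (h - g)
      \<le> (norm (h - g) / (2 * c0)) powr (q - 1)" if "h \<noteq> g" for h
  proof -
    obtain y where y: "h \<in> subdifferential \<phi> y" using subgradient_surjective by auto
    have "norm (conj_real h - conj_real g - (h - g) x) \<le> (h - g) (y - x)"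
      using conj_real_subgradient[OF g, of h] conj_real_subgradient[OF y, of g]
      by (simp add: blinfun.diff_left blinfun.diff_right)
    also have "\<dots> \<le> norm (h - g) * norm (y - x)" using norm_blinfun[of "h - g" "y - x"] by simp
    also have "\<dots> \<le> norm (h - g) * (norm (h - g) / (2 * c0)) powr (q - 1)"
      by (intro mult_left_mono subgradient_Hoelder[OF y g]) simp
    finally show ?thesis using that by (simp add: field_simps)
  qed
  note bound = this
  have "((\<lambda>h. (norm (h - g) / (2 * c0)) powr (q - 1)) \<longlongrightarrow> 0) (at g)"
  proof (rule tendsto_zero_powrI)
    have "((\<lambda>h. norm (h - g) / (2 * c0)) \<longlongrightarrow> norm (g - g) / (2 * c0)) (at g)"
      using c0_pos by (intro tendsto_intros) auto
    then show "((\<lambda>h. norm (h - g) / (2 * c0)) \<longlongrightarrow> 0) (at g)" by simp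
    show "((\<lambda>h. q - 1) \<longlongrightarrow> q - 1) (at g)" by (rule tendsto_const)
  next show "0 < q - 1" using q_gt_1 by simp
  next show "\<forall>\<^sub>F h in at g. 0 \<le> norm (h - g) / (2 * c0)"
      using c0_pos by simp
  qed
  then show "((\<lambda>h. norm (conj_real h - conj_real g - (h - g) x) / norm (h - g)) \<longlongrightarrow> 0) (at g)"
  proof (rule Lim_null_comparison[rotated])
    show "\<forall>\<^sub>F h in at g. norm (norm (conj_real h - conj_real g - (h - g) x) / norm (h - g))
        \<le> (norm (h - g) / (2 * c0)) powr (q - 1)"
      using eventually_neq_at_within[of g g UNIV] by (rule eventually_mono) (use bound in simp)
  qed
qed

text \<open>Weak lower semicontinuity also shows that the dual separates points as far as needed: a point
  that no functional distinguishes from the minimiser is itself a minimiser.\<close>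

lemma grad_conjugate_eq:
  assumes g: "g \<in> subdifferential \<phi> x"
  shows "m g = x"
  unfolding grad_conjugate_def
proof (rule the_equality)
  show "(conj_real has_derivative (\<lambda>h. h x)) (at g)" by (rule conj_real_has_derivative[OF g])
  fix y :: 'u assume y: "(conj_real has_derivative (\<lambda>h. h y)) (at g)"
  have "(\<lambda>h :: 'u dual. h y) = (\<lambda>h. h x)"
    by (rule has_derivative_unique[OF y conj_real_has_derivative[OF g]])
  then have same: "h y = h x" for h :: "'u dual" by metis
  then have "weakly_converges (\<lambda>n. x) y" by (simp add: weakly_converges_def)
  then have "\<phi> y \<le> liminf (\<lambda>n. \<phi> x)" using lsc by (auto simp: weakly_lsc_def)
  then have le: "\<phi> y \<le> \<phi> x" by (simp add: Liminf_const)
  have "\<phi> x < \<infinity>" using subgradient_dom[OF g] by (simp add: eff_dom_def)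
  then have y_dom: "y \<in> eff_dom \<phi>"
    using le_less_trans[OF le] by (simp add: eff_dom_def del: ereal_infty_less)
  have "\<phi>r y \<le> \<phi>r x" using le \<phi>_eq[OF y_dom] \<phi>_eq[OF subgradient_dom[OF g]] by (metis ereal_less_eq(3))
  have "\<phi>r y + g (z - y) \<le> \<phi>r z" if "z \<in> eff_dom \<phi>" for z
  proof -
    have "\<phi>r x + g (z - x) \<le> \<phi>r z" using g that by (simp add: subdifferential_iff)
    then show ?thesis using \<open>\<phi>r y \<le> \<phi>r x\<close> by (simp add: blinfun.diff_right same)
  qed
  then have "g \<in> subdifferential \<phi> y" using y_dom by (simp add: subdifferential_iff)
  then show "y = x" using g by (rule subgradient_unique)
qed

lemma grad_conjugate_subgradient: "g \<in> subdifferential \<phi> (m g)"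
  using subgradient_surjective[of g] grad_conjugate_eq by metis

lemma grad_conjugate_dom: "m g \<in> eff_dom \<phi>"
  by (rule subgradient_dom[OF grad_conjugate_subgradient])

text \<open>Along the segment from \<open>g\<close> to \<open>g + h\<close> the derivative departs
  from its initial value by a multiple of \<open>t powr (q - 1)\<close>; integration over the unit
  interval produces the factor \<open>1 / q\<close>.\<close>

lemma conj_real_smooth:
  "conj_real (g + h) \<le> conj_real g + h (m g) + norm h powr q / (q * (2 * c0) powr (q - 1))"
proof -
  define c where "c = norm h powr q / (q * (2 * c0) powr (q - 1))"
  define D where "D t = conj_real (g + t *\<^sub>R h) - t * h (m g) - c * t powr q" for t
  have conj_deriv: "((\<lambda>t. conj_real (g + t *\<^sub>R h)) has_real_derivative h (m (g + t *\<^sub>R h))) (at t)" for t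
  proof -
    have "((\<lambda>t. g + t *\<^sub>R h) has_derivative (\<lambda>s. s *\<^sub>R h)) (at t)"
      by (auto intro!: derivative_eq_intros)
    from has_derivative_compose[OF this conj_real_has_derivative[OF grad_conjugate_subgradient]]
    show ?thesis by (simp add: has_field_derivative_def blinfun.scaleR_left mult_commute_abs)
  qed
  have "D 1 \<le> D 0"
  \<comment> \<open>Monotonicity of \<open>D\<close> takes the place of the integral. The power
    \<open>t powr q\<close> is differentiated only for \<open>t > 0\<close>, so the endpoint 0 is
    reached by continuity.\<close>
  proof (rule DERIV_nonpos_imp_decreasing_open[where f = D and a = 0 and b = 1])
    fix t :: real assume t: "0 < t" "t < 1"
    define y where "y = m (g + t *\<^sub>R h) - m g"
    have "norm y \<le> (norm (t *\<^sub>R h) / (2 * c0)) powr (q - 1)"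
      using subgradient_Hoelder[OF grad_conjugate_subgradient grad_conjugate_subgradient,
          of "g + t *\<^sub>R h" g] by (simp add: y_def)
    also have "\<dots> = t powr (q - 1) * norm h powr (q - 1) / (2 * c0) powr (q - 1)"
      using t c0_pos by (simp add: powr_divide powr_mult)
    finally have "norm h * norm y \<le> norm h * (t powr (q - 1) * norm h powr (q - 1) / (2 * c0) powr (q - 1))"
      by (rule mult_left_mono) simp
    also have "\<dots> = c * (q * t powr (q - 1))"
      using q_gt_1 by (cases "h = 0") (simp_all add: c_def powr_diff mult_ac)
    finally have "h y \<le> c * (q * t powr (q - 1))" using norm_blinfun[of h y] by simp
    moreover have "(D has_real_derivative h (m (g + t *\<^sub>R h)) - h (m g) - c * (q * t powr (q - 1))) (at t)"
    proof -
      have "((\<lambda>t. t * h (m g)) has_real_derivative h (m g)) (at t)"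
        by (auto intro!: derivative_eq_intros)
      moreover have "((\<lambda>t. c * t powr q) has_real_derivative c * (q * t powr (q - 1))) (at t)"
        using t by (auto intro!: derivative_eq_intros)
      ultimately show ?thesis unfolding D_def by (intro DERIV_diff conj_deriv)
    qed
    ultimately show "\<exists>d. (D has_real_derivative d) (at t) \<and> d \<le> 0"
      by (intro exI conjI) (auto simp: y_def blinfun.diff_right)
  next
    have "continuous_on {0..1} (\<lambda>t. conj_real (g + t *\<^sub>R h))"
      using DERIV_isCont[OF conj_deriv] by (simp add: continuous_at_imp_continuous_on)
    then show "continuous_on {0..1} D" unfolding D_def
      using q_gt_1 by (intro continuous_intros continuous_on_powr') auto
  qed simp
  then show ?thesis using q_gt_1 by (simp add: D_def c_def)
qed

section \<open>Descent of the Bregman distance\<close>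

text \<open>The Bregman distance from \<open>m g\<close> to \<open>y\<close> with the base point
  eliminated by Fenchel's equality, so that only the dual variable moves during the iteration. It
  represents \<open>bregman\<close> for \<open>y\<close> in the effective domain.\<close>

definition breg :: "'u dual \<Rightarrow> 'u \<Rightarrow> real" where
  "breg g y = \<phi>r y - g y + conj_real g"

lemma bregman_eq_breg:
  assumes "y \<in> eff_dom \<phi>"
  shows "bregman \<phi> g y (m g) = ereal (breg g y)"
  using bregman_eq[OF grad_conjugate_dom assms, of g g]
  by (simp add: breg_def conj_real_eq[OF grad_conjugate_subgradient] blinfun.diff_right)

lemma breg_ge:
  assumes "y \<in> eff_dom \<phi>"
  shows "c0 * norm (y - m g) powr p \<le> breg g y"
  using subgradient_lower[OF grad_conjugate_subgradient assms, of g]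
  by (simp add: breg_def conj_real_eq[OF grad_conjugate_subgradient] blinfun.diff_right)

lemma breg_nonneg: "y \<in> eff_dom \<phi> \<Longrightarrow> 0 \<le> breg g y"
  using breg_ge[of y g] c0_pos by (meson less_imp_le mult_nonneg_nonneg order_trans powr_ge_zero)

text \<open>The form \<open>B * R powr p\<close> covers both uses: level sets, with \<open>R\<close>
  a multiple of \<open>\<epsilon>\<close>, and stability estimates, with \<open>R\<close> a bound on
  the residual.\<close>

lemma norm_le_of_breg_le:
  assumes y: "y \<in> eff_dom \<phi>" and le: "breg g y \<le> B * R powr p" and "B \<ge> 0" "R \<ge> 0"
  shows "norm (y - m g) \<le> (B / c0) powr (1 / p) * R"
proof -
  have "c0 * norm (y - m g) powr p \<le> B * R powr p" using breg_ge[OF y, of g] le by linarith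
  then have "norm (y - m g) powr p \<le> B / c0 * R powr p" using c0_pos by (simp add: field_simps)
  then have "(norm (y - m g) powr p) powr (1 / p) \<le> (B / c0 * R powr p) powr (1 / p)"
    using p_gt_1 by (intro powr_mono2) auto
  also have "(B / c0 * R powr p) powr (1 / p) = (B / c0) powr (1 / p) * R"
    using p_gt_1 assms c0_pos by (simp add: powr_powr powr_mult del: times_divide_eq_left)
  finally show ?thesis using p_gt_1 by (simp add: powr_powr)
qed

lemma breg_smooth:
  "breg (g + h) y \<le> breg g y + h (m g - y) + norm h powr q / (q * (2 * c0) powr (q - 1))"
  using conj_real_smooth[of g h] by (simp add: breg_def blinfun.add_left blinfun.diff_right)

text \<open>Two applications of \<open>breg_smooth\<close> at \<open>g\<close>: the extrapolating
  increment contributes \<open>l powr q\<close>, and the step back to \<open>g'\<close>, which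
  bounds the linear term, contributes \<open>l\<close>. If the distance did not increase from
  \<open>g'\<close> to \<open>g\<close>, only this last term remains.\<close>

lemma breg_extrapolation:
  assumes "l \<ge> 0"
  shows "breg (g + l *\<^sub>R (g - g')) y \<le> breg g y + l * (breg g y - breg g' y)
    + (l + l powr q) / (q * (2 * c0) powr (q - 1)) * norm (g - g') powr q"
proof -
  define \<kappa> where "\<kappa> = q * (2 * c0) powr (q - 1)"
  have "breg (g + l *\<^sub>R (g - g')) y
      \<le> breg g y + l * (g - g') (m g - y) + l powr q * norm (g - g') powr q / \<kappa>"
    using breg_smooth[of g "l *\<^sub>R (g - g')" y] assms
    by (simp add: \<kappa>_def blinfun.scaleR_left powr_mult)
  moreover have "(g - g') (m g - y) \<le> breg g y - breg g' y + norm (g - g') powr q / \<kappa>"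
    using breg_smooth[of g "g' - g" y] by (simp add: \<kappa>_def blinfun.diff_left norm_minus_commute)
  from mult_left_mono[OF this assms]
  have "l * (g - g') (m g - y) \<le> l * (breg g y - breg g' y) + l * norm (g - g') powr q / \<kappa>"
    by (simp add: algebra_simps)
  ultimately show ?thesis unfolding \<kappa>_def[symmetric] by (simp add: add_divide_distrib distrib_right)
qed

text \<open>The factor \<open>1/2\<close> in the step size yields the \<open>2 powr (q - 1)\<close>
  demanded by \<open>powr_add_le\<close>, and the conjugate exponents turn the denominator
  \<open>d powr p\<close> into \<open>d powr q\<close>.\<close>

lemma step_size_bound:
  assumes "\<theta>1 powr (q - 1) * \<rho> powr s - \<theta>2 * t powr q > 0" (is "?A > 0")
    and "\<rho> > \<tau> * \<delta>" "\<rho> > 0" "\<theta>3 > 0" "d \<ge> 0"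
  defines "\<upsilon> \<equiv> step_size p q s \<theta>1 \<theta>2 \<theta>3 \<tau> \<delta> \<rho> d t"
  shows "\<upsilon> > 0" and "2 powr (q - 1) * (\<upsilon> * d) powr q \<le> \<upsilon> * ?A"
proof -
  show \<upsilon>: "\<upsilon> > 0" using assms by (auto simp: \<upsilon>_def step_size_def)
  show "2 powr (q - 1) * (\<upsilon> * d) powr q \<le> \<upsilon> * ?A"
  proof (cases "d = 0")
    case True
    then show ?thesis using \<upsilon> assms(1) by simp
  next
    case False
    then have d: "d > 0" using assms by simp
    have "2 * \<upsilon> \<le> ?A powr (1 / (q - 1)) / d powr p"
      using assms False by (auto simp: \<upsilon>_def step_size_def)
    then have "(2 * \<upsilon>) powr (q - 1) \<le> (?A powr (1 / (q - 1)) / d powr p) powr (q - 1)"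
      using \<upsilon> q_gt_1 by (intro powr_mono2) auto
    also have "\<dots> = ?A / d powr (p * (q - 1))"
      using assms(1) q_gt_1 by (simp add: powr_divide powr_powr)
    also have "p * (q - 1) = q" by (simp add: q_minus_1) (simp add: q_eq)
    finally have "(2 * \<upsilon>) powr (q - 1) * d powr q \<le> ?A" using d by (simp add: field_simps)
    from mult_left_mono[OF this, of \<upsilon>] show ?thesis
      using \<upsilon> d by (simp add: powr_mult powr_diff mult_ac)
  qed
qed

text \<open>The constant collects one term per effect: 1 from pairing the duality mapping with the
  residual, \<open>\<eta>\<close> from the linearisation error, the \<open>\<theta>4\<close> term
  from the relaxation towards \<open>\<gamma>0\<close>, the \<open>\<theta>1\<close> term from the
  second-order part of \<open>breg_smooth\<close>, and everything over \<open>\<tau>\<close> from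
  the noise.\<close>

lemma descent:
  fixes F :: "'u \<Rightarrow> 'v::real_normed_vector" and L :: "'u \<Rightarrow>\<^sub>L 'v" and vd :: 'v
    and \<xi> \<gamma>0 :: "'u dual" and s :: real
  defines "w \<equiv> m \<xi>"
  defines "\<rho> \<equiv> norm (F w - vd)" and "t \<equiv> norm (\<xi> - \<gamma>0)"
    and "A \<equiv> dual_map L (duality_mapping s (F w - vd))"
  assumes smooth: "uniformly_smooth TYPE('v)" and s: "s > 1" and y: "y \<in> eff_dom \<phi>"
    and noise: "norm (F y - vd) \<le> \<delta>" "\<tau> * \<delta> < \<rho>" "\<tau> > 0" "\<rho> > 0"
    and cone: "norm (F y - F w - L (y - w)) \<le> \<eta> * norm (F y - F w)" "0 \<le> \<eta>"
    and stability: "breg \<xi> y \<le> C * norm (F y - F w) powr p" "C > 0"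
    and step: "\<upsilon> \<ge> 0"
      "2 powr (q - 1) * (\<upsilon> * norm A) powr q \<le> \<upsilon> * (\<theta>1 powr (q - 1) * \<rho> powr s - \<theta>2 * t powr q)"
    and a: "a \<ge> 0" "a * t \<le> \<theta>4 * \<upsilon> * \<rho> powr (s - 1)" "\<theta>4 \<ge> 0"
      "2 powr (q - 1) * (a * t) powr q \<le> \<upsilon> * (\<theta>2 * t powr q)"
  shows "breg ((1 - a) *\<^sub>R \<xi> - \<upsilon> *\<^sub>R A + a *\<^sub>R \<gamma>0) y \<le> breg \<xi> y
    - (1 - (C / c0) powr (1 / p) * \<theta>4 - \<eta> - \<theta>1 powr (q - 1) / (q * (2 * c0) powr (q - 1))
       - ((C / c0) powr (1 / p) * \<theta>4 + (1 + \<eta>)) / \<tau>) * \<upsilon> * \<rho> powr s"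
proof -
  define \<kappa> where "\<kappa> = q * (2 * c0) powr (q - 1)"
  define K where "K = (C / c0) powr (1 / p)"
  define j where "j = duality_mapping s (F w - vd)"
  define h where "h = - \<upsilon> *\<^sub>R A - a *\<^sub>R (\<xi> - \<gamma>0)"
  define P where "P = \<rho> powr (s - 1)"
  have \<kappa>: "\<kappa> > 0" using q_gt_1 c0_pos by (simp add: \<kappa>_def)
  have P: "P \<ge> 0" "P * \<rho> = \<rho> powr s" using noise(4) by (simp_all add: P_def powr_diff)
  \<comment> \<open>Before stopping, the noise is a fixed fraction of the residual; every division
    by \<open>\<tau>\<close> below originates here.\<close>
  have \<delta>: "\<delta> \<le> \<rho> / \<tau>" using noise by (simp add: field_simps)
  define M where "M = norm (F y - F w)"
  have M: "M \<le> \<rho> + \<delta>"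
    using norm_triangle_ineq4[of "F y - vd" "F w - vd"] noise(1) by (simp add: M_def \<rho>_def)
  have j_le: "j x \<le> P * norm x" for x
    using norm_blinfun[of j x] norm_duality_mapping[OF smooth s, of "F w - vd"]
    by (simp add: j_def P_def \<rho>_def)
  have j_self: "j (F w - vd) = \<rho> powr s"
    using duality_mapping_self[OF smooth s] by (simp add: j_def \<rho>_def)

  \<comment> \<open>Second-order part: the amount \<open>\<theta>2 * t powr q\<close> withheld in
    the step size exactly absorbs the relaxation bounded by \<open>a(4)\<close>.\<close>
  have "norm h \<le> norm (\<upsilon> *\<^sub>R A) + norm (a *\<^sub>R (\<xi> - \<gamma>0))"
    unfolding h_def using norm_triangle_ineq4[of "- \<upsilon> *\<^sub>R A" "a *\<^sub>R (\<xi> - \<gamma>0)"] by simp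
  also have "\<dots> = \<upsilon> * norm A + a * t" using step(1) a(1) by (simp add: t_def)
  finally have "norm h powr q \<le> (\<upsilon> * norm A + a * t) powr q" using q_gt_1 by (intro powr_mono2) auto
  also have "\<dots> \<le> 2 powr (q - 1) * ((\<upsilon> * norm A) powr q + (a * t) powr q)"
    using q_gt_1 step(1) a(1) by (intro powr_add_le) (auto simp: t_def)
  also have "\<dots> \<le> \<upsilon> * \<theta>1 powr (q - 1) * \<rho> powr s" using step(2) a(4) by (simp add: algebra_simps)
  finally have second: "norm h powr q / \<kappa> \<le> \<theta>1 powr (q - 1) / \<kappa> * \<upsilon> * \<rho> powr s"
    using \<kappa> by (simp add: field_simps)

  \<comment> \<open>First-order part: \<open>L (y - w)\<close> splits into the data error at
    \<open>y\<close>, the negative residual at \<open>w\<close>, which yields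
    \<open>- \<rho> powr s\<close>, and the cone error \<open>e\<close>.\<close>
  define e where "e = F y - F w - L (y - w)"
  have "- A (w - y) = j (L (y - w))"
    by (simp add: A_def dual_map_def j_def blinfun.diff_right)
  also have "L (y - w) = (F y - vd) - (F w - vd) - e" by (simp add: e_def)
  also have "j \<dots> = j (F y - vd) - \<rho> powr s + j (- e)"
    by (simp add: blinfun.diff_right blinfun.minus_right flip: j_self)
  also have "\<dots> \<le> P * (\<rho> / \<tau>) - \<rho> powr s + P * (\<eta> * (\<rho> + \<rho> / \<tau>))"
  proof -
    have "j (F y - vd) \<le> P * (\<rho> / \<tau>)"
      using j_le[of "F y - vd"] mult_left_mono[OF order_trans[OF noise(1) \<delta>] P(1)] by linarith
    moreover have "norm e \<le> \<eta> * (\<rho> + \<rho> / \<tau>)"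
      using cone(1) mult_left_mono[OF _ cone(2), of M "\<rho> + \<rho> / \<tau>"] M \<delta> by (simp add: e_def M_def)
    then have "j (- e) \<le> P * (\<eta> * (\<rho> + \<rho> / \<tau>))"
      using j_le[of "- e"] mult_left_mono[OF _ P(1), of "norm e"] by fastforce
    ultimately show ?thesis by linarith
  qed
  also have "\<dots> = - (1 - \<eta> - (1 + \<eta>) / \<tau>) * \<rho> powr s"
    unfolding P(2)[symmetric] by (simp add: algebra_simps add_divide_distrib)
  finally have first: "- (\<upsilon> * A (w - y)) \<le> - (1 - \<eta> - (1 + \<eta>) / \<tau>) * \<upsilon> * \<rho> powr s"
    using mult_left_mono[OF _ step(1), of "- A (w - y)" "- (1 - \<eta> - (1 + \<eta>) / \<tau>) * \<rho> powr s"]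
    by (simp add: mult_ac)

  \<comment> \<open>Stability trades the distance for one factor \<open>\<rho>\<close>; with
    \<open>a * t\<close> of order \<open>\<rho> powr (s - 1)\<close> the relaxation reaches the
    common order \<open>\<rho> powr s\<close>.\<close>
  have "norm (w - y) \<le> K * (\<rho> + \<rho> / \<tau>)"
  proof -
    have "norm (w - y) \<le> K * M"
      using norm_le_of_breg_le[OF y stability(1)] stability(2)
      by (simp add: K_def M_def w_def norm_minus_commute)
    also have "\<dots> \<le> K * (\<rho> + \<rho> / \<tau>)" using M \<delta> by (intro mult_left_mono) (auto simp: K_def)
    finally show ?thesis .
  qed
  then have "(a * t) * norm (w - y) \<le> (\<theta>4 * \<upsilon> * P) * (K * (\<rho> + \<rho> / \<tau>))"
    using a step(1) P(1) by (intro mult_mono[OF a(2)[folded P_def]]) auto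
  moreover have "- (a * (\<xi> - \<gamma>0) (w - y)) \<le> (a * t) * norm (w - y)"
    using mult_left_mono[OF _ a(1), of "- (\<xi> - \<gamma>0) (w - y)" "t * norm (w - y)"]
      norm_blinfun[of "\<xi> - \<gamma>0" "w - y"] by (auto simp: t_def mult.assoc)
  moreover have "(\<theta>4 * \<upsilon> * P) * (K * (\<rho> + \<rho> / \<tau>)) = (K * \<theta>4 + K * \<theta>4 / \<tau>) * \<upsilon> * \<rho> powr s"
    unfolding P(2)[symmetric] by (simp add: field_simps)
  ultimately have relax: "- (a * (\<xi> - \<gamma>0) (w - y)) \<le> (K * \<theta>4 + K * \<theta>4 / \<tau>) * \<upsilon> * \<rho> powr s"
    by linarith

  have "(1 - a) *\<^sub>R \<xi> - \<upsilon> *\<^sub>R A + a *\<^sub>R \<gamma>0 = \<xi> + h" by (simp add: h_def algebra_simps)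
  then have "breg ((1 - a) *\<^sub>R \<xi> - \<upsilon> *\<^sub>R A + a *\<^sub>R \<gamma>0) y
      \<le> breg \<xi> y + h (w - y) + norm h powr q / \<kappa>"
    using breg_smooth[of \<xi> h y] by (simp add: w_def \<kappa>_def)
  also have "h (w - y) = - (\<upsilon> * A (w - y)) + - (a * (\<xi> - \<gamma>0) (w - y))"
    by (simp add: h_def blinfun.diff_left blinfun.minus_left blinfun.scaleR_left)
  finally have "breg ((1 - a) *\<^sub>R \<xi> - \<upsilon> *\<^sub>R A + a *\<^sub>R \<gamma>0) y
      \<le> breg \<xi> y - (1 - \<eta> - (1 + \<eta>) / \<tau>) * \<upsilon> * \<rho> powr s
        + (K * \<theta>4 + K * \<theta>4 / \<tau>) * \<upsilon> * \<rho> powr s + \<theta>1 powr (q - 1) / \<kappa> * \<upsilon> * \<rho> powr s"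
    using first relax second by linarith
  also have "\<dots> = breg \<xi> y - (1 - K * \<theta>4 - \<eta> - \<theta>1 powr (q - 1) / \<kappa> - (K * \<theta>4 + (1 + \<eta>)) / \<tau>) * \<upsilon> * \<rho> powr s"
    by (simp add: algebra_simps add_divide_distrib)
  finally show ?thesis by (simp add: K_def \<kappa>_def)
qed

end

section \<open>Convergence at the stopping index\<close>

theorem theorem3p2:
  fixes F :: "'u::banach \<Rightarrow> 'v::banach" and DF :: "'u set"
    and \<phi> :: "'u \<Rightarrow> ereal"
    and L :: "'u \<Rightarrow> 'u \<Rightarrow>\<^sub>L 'v"
    and v :: 'v and v\<delta> :: "real \<Rightarrow> 'v"
    and u0 ustar :: 'u and \<gamma>0 :: "'u dual"
    and p q s c0 \<epsilon> C C0 \<eta> \<tau> \<theta>1 \<theta>2bar \<theta>3 \<theta>4 \<theta>5 \<zeta> :: real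
    and \<theta>2 \<alpha> :: "nat \<Rightarrow> real"
    and lam \<upsilon> t :: "real \<Rightarrow> nat \<Rightarrow> real"
    and \<gamma> \<xi> :: "real \<Rightarrow> nat \<Rightarrow> 'u dual"
    and u w :: "real \<Rightarrow> nat \<Rightarrow> 'u" and r :: "real \<Rightarrow> nat \<Rightarrow> 'v"
    and kstop :: "real \<Rightarrow> nat"
  assumes U_reflexive: "reflexive_space TYPE('u)"
    and V_smooth: "uniformly_smooth TYPE('v)"
    and exponents: "p > 1" "1/p + 1/q = 1" "s > 1"
    and a1: "weakly_closed_on DF F"
    and a2: "proper_fun \<phi>" "weakly_lsc \<phi>" "c0 > 0" "p_convex p c0 \<phi>"
      "\<And>u' u g. u \<in> dom_subdifferential \<phi> \<Longrightarrow> g \<in> subdifferential \<phi> u \<Longrightarrow>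
         bregman \<phi> g u' u \<ge> ereal (c0 * norm (u - u') powr p)"
    and a3: "\<gamma>0 \<in> subdifferential \<phi> u0" "\<epsilon> > 0"
      "ustar \<in> eff_dom \<phi>" "ustar \<in> DF" "F ustar = v"
      "bregman \<phi> \<gamma>0 ustar u0 \<le> ereal (c0 * \<epsilon> powr p)"
      "cball u0 (3 * \<epsilon>) \<subseteq> DF"
    and a4: "C > 0"
      "\<And>u' u g. u \<in> cball u0 (3 * \<epsilon>) \<Longrightarrow> u' \<in> cball u0 (3 * \<epsilon>) \<Longrightarrow> g \<in> subdifferential \<phi> u \<Longrightarrow>
         bregman \<phi> g u' u \<le> ereal (C * norm (F u' - F u) powr p)"
    and a5: "continuous_on (cball u0 (3 * \<epsilon>) \<inter> eff_dom \<phi>) L" "0 \<le> \<eta>" "\<eta> < 1"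
      "\<And>u' u. u \<in> cball u0 (3 * \<epsilon>) \<inter> eff_dom \<phi> \<Longrightarrow> u' \<in> cball u0 (3 * \<epsilon>) \<inter> eff_dom \<phi> \<Longrightarrow>
         norm (F u' - F u - L u (u' - u)) \<le> \<eta> * norm (F u' - F u)"
    and a6: "C0 > 0" "\<And>u. u \<in> cball u0 (3 * \<epsilon>) \<inter> eff_dom \<phi> \<Longrightarrow> norm (L u) \<le> C0"
    and noise: "\<And>\<delta>. \<delta> > 0 \<Longrightarrow> norm (v - v\<delta> \<delta>) \<le> \<delta>" "v\<delta> 0 = v"
    and constants: "\<tau> > 1" "\<theta>1 > 0" "\<theta>2bar > 0" "\<theta>3 > 0" "\<theta>4 > 0" "\<zeta> > 1"
      "\<And>k. \<theta>2 k > 0" "\<And>k. 0 \<le> \<alpha> k" "\<And>k. \<alpha> k \<le> 1" "\<And>\<delta> k. \<delta> \<ge> 0 \<Longrightarrow> lam \<delta> k \<ge> 0"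
    and iteration:
      "\<And>\<delta>. \<delta> \<ge> 0 \<Longrightarrow> \<gamma> \<delta> 0 = \<gamma>0"
      "\<And>\<delta>. \<delta> \<ge> 0 \<Longrightarrow> u \<delta> 0 = u0"
      "\<And>\<delta> k. \<delta> \<ge> 0 \<Longrightarrow> \<xi> \<delta> k = \<gamma> \<delta> k + lam \<delta> k *\<^sub>R (\<gamma> \<delta> k - prev \<gamma>0 (\<gamma> \<delta>) k)"
      "\<And>\<delta> k. \<delta> \<ge> 0 \<Longrightarrow> w \<delta> k = grad_conjugate \<phi> (\<xi> \<delta> k)"
      "\<And>\<delta> k. \<delta> \<ge> 0 \<Longrightarrow> r \<delta> k = F (w \<delta> k) - v\<delta> \<delta>"
      "\<And>\<delta> k. \<delta> \<ge> 0 \<Longrightarrow> t \<delta> k = norm (\<xi> \<delta> k - \<gamma>0)"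
      "\<And>\<delta> k. \<delta> \<ge> 0 \<Longrightarrow> \<upsilon> \<delta> k =
         step_size p q s \<theta>1 (\<theta>2 k) \<theta>3 \<tau> \<delta> (norm (r \<delta> k))
           (norm (dual_map (L (w \<delta> k)) (duality_mapping s (r \<delta> k)))) (t \<delta> k)"
      "\<And>\<delta> k. \<delta> \<ge> 0 \<Longrightarrow> \<gamma> \<delta> (Suc k) =
         (1 - \<alpha> k) *\<^sub>R \<xi> \<delta> k
         - \<upsilon> \<delta> k *\<^sub>R dual_map (L (w \<delta> k)) (duality_mapping s (r \<delta> k)) + \<alpha> k *\<^sub>R \<gamma>0"
      "\<And>\<delta> k. \<delta> \<ge> 0 \<Longrightarrow> u \<delta> (Suc k) = grad_conjugate \<phi> (\<gamma> \<delta> (Suc k))"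
    and \<theta>2_choice:
      "\<And>\<delta> k. \<delta> \<ge> 0 \<Longrightarrow> norm (r \<delta> k) > \<tau> * \<delta> \<Longrightarrow>
         \<theta>2 k * t \<delta> k powr q \<le> \<theta>2bar powr (q - 1) * norm (r \<delta> k) powr s
         \<and> \<theta>2bar powr (q - 1) * norm (r \<delta> k) powr s \<le> \<theta>1 powr (q - 1) * norm (r \<delta> k) powr s
         \<and> \<theta>1 powr (q - 1) * norm (r \<delta> k) powr s - \<theta>2 k * t \<delta> k powr q > 0"
    and \<alpha>_choice:
      "\<And>\<delta> k. \<delta> \<ge> 0 \<Longrightarrow> \<upsilon> \<delta> k \<noteq> 0 \<Longrightarrow> t \<delta> k \<noteq> 0 \<Longrightarrow>
         \<alpha> k \<le> min (\<theta>4 * \<upsilon> \<delta> k * norm (F (w \<delta> k) - v\<delta> \<delta>) powr (s - 1) * inverse (t \<delta> k))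
                   (2 powr ((1 - q) / q) * (\<theta>2 k * \<upsilon> \<delta> k) powr (1 / q))"
    and \<theta>5:
      "\<theta>5 = 1 - (C / c0) powr (1 / p) * \<theta>4 - \<eta> - \<theta>1 powr (q - 1) / (q * (2 * c0) powr (q - 1))
             - ((C / c0) powr (1 / p) * \<theta>4 + (1 + \<eta>)) / \<tau>"
      "\<theta>5 > 0"
    and lam_choice:
      "\<And>\<delta> k. \<delta> \<ge> 0 \<Longrightarrow>
         (lam \<delta> k + lam \<delta> k powr q) / (q * (2 * c0) powr (q - 1))
           * norm (\<gamma> \<delta> k - prev \<gamma>0 (\<gamma> \<delta>) k) powr q
         \<le> \<theta>5 * \<upsilon> \<delta> k / \<zeta> * norm (F (w \<delta> k) - v\<delta> \<delta>) powr s"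
      "\<And>\<delta> k. \<delta> \<ge> 0 \<Longrightarrow>
         (lam \<delta> k + lam \<delta> k powr q) / (q * (2 * c0) powr (q - 1))
           * norm (\<gamma> \<delta> k - prev \<gamma>0 (\<gamma> \<delta>) k) powr q
         \<le> c0 * \<epsilon> powr p"
      "summable (\<lambda>k. lam 0 k * norm (\<gamma> 0 k - prev \<gamma>0 (\<gamma> 0) k))"
      "\<And>k. ((\<lambda>\<delta>. lam \<delta> k) \<longlongrightarrow> lam 0 k) (at_right 0)"
    and \<alpha>_summable: "summable (\<lambda>k. \<alpha> k * norm (\<gamma>0 - \<gamma> 0 k))"
    and discrepancy:
      "\<And>\<delta>. \<delta> > 0 \<Longrightarrow> norm (F (w \<delta> (kstop \<delta>)) - v\<delta> \<delta>) \<le> \<tau> * \<delta>"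
      "\<And>\<delta> k. \<delta> > 0 \<Longrightarrow> k < kstop \<delta> \<Longrightarrow> \<tau> * \<delta> < norm (F (w \<delta> k) - v\<delta> \<delta>)"
  shows "\<exists>ubar \<in> cball u0 (2 * \<epsilon>) \<inter> eff_dom \<phi>.
           ubar \<in> DF \<and> F ubar = v
           \<and> ((\<lambda>\<delta>. bregman \<phi> (\<gamma> \<delta> (kstop \<delta>)) ubar (u \<delta> (kstop \<delta>))) \<longlongrightarrow> 0) (at_right 0)
           \<and> ((\<lambda>\<delta>. norm (u \<delta> (kstop \<delta>) - ubar)) \<longlongrightarrow> 0) (at_right 0)"
proof -
  interpret strongly_convex_function \<phi> p q c0
    using exponents a2 a3(1) by unfold_locales auto
  define y where "y = ustar"
  have y: "y \<in> eff_dom \<phi>" "F y = v" using a3 by (simp_all add: y_def)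
  have u0_eq: "u0 = grad_conjugate \<phi> \<gamma>0" using grad_conjugate_eq[OF a3(1)] by simp
  have breg0: "breg \<gamma>0 y \<le> c0 * \<epsilon> powr p"
    using a3(6) bregman_eq_breg[OF y(1), of \<gamma>0] by (simp add: u0_eq y_def)
  have near_u0: "norm (y - u0) \<le> \<epsilon>"
    using norm_le_of_breg_le[OF y(1) breg0] a2(3) a3(2) by (simp add: u0_eq)
  have y_ball: "y \<in> cball u0 (3 * \<epsilon>)" "y \<in> cball u0 (2 * \<epsilon>)"
    using near_u0 a3(2) by (simp_all add: dist_norm norm_minus_commute)
  \<comment> \<open>The factor 2 leaves room for one level of the iterate and one of the
    extrapolation. As \<open>2 \<le> 2 powr p\<close>, it costs a radius
    \<open>2 * \<epsilon>\<close> about \<open>y\<close>, to which the distance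
    \<open>\<epsilon>\<close> from \<open>y\<close> to \<open>u0\<close> is added.\<close>
  have ball: "grad_conjugate \<phi> g \<in> cball u0 (3 * \<epsilon>)" if "breg g y \<le> 2 * (c0 * \<epsilon> powr p)" for g
  proof -
    have "(2 :: real) powr 1 \<le> 2 powr p" using exponents(1) by (intro powr_mono) auto
    then have "c0 * \<epsilon> powr p * 2 \<le> c0 * \<epsilon> powr p * 2 powr p"
      using a2(3) by (intro mult_left_mono) auto
    then have "breg g y \<le> c0 * (2 * \<epsilon>) powr p"
      using that a3(2) by (simp add: powr_mult mult_ac)
    then have "norm (y - grad_conjugate \<phi> g) \<le> 2 * \<epsilon>"
      using norm_le_of_breg_le[OF y(1)] a2(3) a3(2) by fastforce
    then have "norm (u0 - grad_conjugate \<phi> g) \<le> 3 * \<epsilon>"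
      using norm_triangle_ineq[of "u0 - y" "y - grad_conjugate \<phi> g"] near_u0
      by (simp add: norm_minus_commute)
    then show ?thesis by (simp add: dist_norm)
  qed
  have stability: "breg g y \<le> C * norm (F y - F (grad_conjugate \<phi> g)) powr p"
    if "breg g y \<le> 2 * (c0 * \<epsilon> powr p)" for g
    using a4(2)[OF ball[OF that] y_ball(1) grad_conjugate_subgradient] bregman_eq_breg[OF y(1)] by simp
  have u_eq: "u \<delta> k = grad_conjugate \<phi> (\<gamma> \<delta> k)" if "\<delta> \<ge> 0" for \<delta> k
    using that iteration(1,2,9) u0_eq by (cases k) auto

  have stop: "breg (\<gamma> \<delta> (kstop \<delta>)) y \<le> C * ((\<tau> + 1) * \<delta>) powr p" if \<delta>: "\<delta> > 0" for \<delta>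
  proof -
    have \<delta>0: "\<delta> \<ge> 0" using \<delta> by simp
    note it = iteration[OF \<delta>0]
    define T where "T k = (lam \<delta> k + lam \<delta> k powr q) / (q * (2 * c0) powr (q - 1))
      * norm (\<gamma> \<delta> k - prev \<gamma>0 (\<gamma> \<delta>) k) powr q" for k
    define \<rho> where "\<rho> k = norm (r \<delta> k)" for k
    have T_le: "T k \<le> \<theta>5 * \<upsilon> \<delta> k / \<zeta> * \<rho> k powr s" "T k \<le> c0 * \<epsilon> powr p" for k
      using lam_choice(1,2)[OF \<delta>0, of k] by (simp_all add: T_def \<rho>_def it(5))
    have extrapolation: "breg (\<xi> \<delta> k) y \<le> breg (\<gamma> \<delta> k) y + T k"
      if "breg (\<gamma> \<delta> k) y \<le> breg (prev \<gamma>0 (\<gamma> \<delta>) k) y" for k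
    proof -
      have "lam \<delta> k * (breg (\<gamma> \<delta> k) y - breg (prev \<gamma>0 (\<gamma> \<delta>) k) y) \<le> 0"
        using constants(10)[OF \<delta>0] that by (intro mult_nonneg_nonpos) auto
      then show ?thesis
        using breg_extrapolation[OF constants(10)[OF \<delta>0], of "\<gamma> \<delta> k" k "prev \<gamma>0 (\<gamma> \<delta>) k" y]
        by (simp add: it(3) T_def)
    qed
    have data: "norm (F y - v\<delta> \<delta>) \<le> \<delta>" using noise(1)[OF \<delta>] y(2) by simp
    \<comment> \<open>The first conjunct tames the extrapolation, the second keeps its result in the
      ball. The range includes \<open>kstop \<delta>\<close>, since the step to \<open>Suc k\<close>
      needs a large residual only at \<open>k\<close>; at 0 \<open>prev\<close> gives
      \<open>\<gamma>0\<close>, so the comparison is trivial.\<close>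
    have monotone: "breg (\<gamma> \<delta> k) y \<le> breg (prev \<gamma>0 (\<gamma> \<delta>) k) y \<and> breg (\<gamma> \<delta> k) y \<le> c0 * \<epsilon> powr p"
      if "k \<le> kstop \<delta>" for k
      using that
    proof (induction k)
      case 0
      then show ?case using breg0 by (simp add: it(1) prev_def)
    next
      case (Suc k)
      then have IH: "breg (\<gamma> \<delta> k) y \<le> breg (prev \<gamma>0 (\<gamma> \<delta>) k) y" "breg (\<gamma> \<delta> k) y \<le> c0 * \<epsilon> powr p"
        by auto
      have w: "w \<delta> k = grad_conjugate \<phi> (\<xi> \<delta> k)" by (rule it(4))
      have breg_\<xi>: "breg (\<xi> \<delta> k) y \<le> 2 * (c0 * \<epsilon> powr p)"
        using extrapolation[OF IH(1)] IH(2) T_le(2)[of k] by linarith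
      have w_dom: "w \<delta> k \<in> cball u0 (3 * \<epsilon>) \<inter> eff_dom \<phi>"
        using ball[OF breg_\<xi>] grad_conjugate_dom by (simp add: w)
      have \<rho>: "\<tau> * \<delta> < \<rho> k" using discrepancy(2)[OF \<delta>, of k] Suc.prems by (simp add: \<rho>_def it(5))
      have "0 < \<tau> * \<delta>" using \<delta> constants(1) by simp
      with \<rho> have \<rho>_pos: "\<rho> k > 0" by linarith
      have res: "\<theta>1 powr (q - 1) * \<rho> k powr s - \<theta>2 k * t \<delta> k powr q > 0"
        using \<theta>2_choice[OF \<delta>0] \<rho> by (simp add: \<rho>_def)
      define A where "A = dual_map (L (w \<delta> k)) (duality_mapping s (r \<delta> k))"
      have \<upsilon>: "\<upsilon> \<delta> k > 0" "2 powr (q - 1) * (\<upsilon> \<delta> k * norm A) powr q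
          \<le> \<upsilon> \<delta> k * (\<theta>1 powr (q - 1) * \<rho> k powr s - \<theta>2 k * t \<delta> k powr q)"
        using step_size_bound[OF res \<rho> \<rho>_pos constants(4), of "norm A"]
        by (simp_all add: it(7) A_def \<rho>_def)
      \<comment> \<open>The bound on \<open>\<alpha>\<close> is available only for
        \<open>t \<delta> k \<noteq> 0\<close>; otherwise both products vanish. In its second entry
        the power of two is chosen to cancel \<open>2 powr (q - 1)\<close> after raising to the
        power \<open>q\<close>.\<close>
      have \<alpha>: "\<alpha> k * t \<delta> k \<le> \<theta>4 * \<upsilon> \<delta> k * \<rho> k powr (s - 1)
        \<and> 2 powr (q - 1) * (\<alpha> k * t \<delta> k) powr q \<le> \<upsilon> \<delta> k * (\<theta>2 k * t \<delta> k powr q)"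
      proof (cases "t \<delta> k = 0")
        case True
        then show ?thesis using \<upsilon>(1) constants(5) by simp
      next
        case False
        then have t: "t \<delta> k > 0" by (simp add: it(6))
        have "\<alpha> k \<le> \<theta>4 * \<upsilon> \<delta> k * \<rho> k powr (s - 1) * inverse (t \<delta> k)"
          and le: "\<alpha> k \<le> 2 powr ((1 - q) / q) * (\<theta>2 k * \<upsilon> \<delta> k) powr (1 / q)"
          using \<alpha>_choice[OF \<delta>0, of k] \<upsilon>(1) False by (simp_all add: \<rho>_def it(5))
        then have 1: "\<alpha> k * t \<delta> k \<le> \<theta>4 * \<upsilon> \<delta> k * \<rho> k powr (s - 1)"
          using t by (simp add: field_simps)
        have "\<alpha> k powr q \<le> (2 powr ((1 - q) / q) * (\<theta>2 k * \<upsilon> \<delta> k) powr (1 / q)) powr q"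
          using le constants(8) q_gt_1 by (intro powr_mono2) auto
        also have "\<dots> = 2 powr (1 - q) * (\<theta>2 k * \<upsilon> \<delta> k)"
          using q_gt_1 constants(7)[of k] \<upsilon>(1) by (simp add: powr_mult powr_powr)
        finally have "2 powr (q - 1) * \<alpha> k powr q \<le> 2 powr (q - 1) * (2 powr (1 - q) * (\<theta>2 k * \<upsilon> \<delta> k))"
          by (rule mult_left_mono) simp
        also have "\<dots> = \<theta>2 k * \<upsilon> \<delta> k" by (simp add: powr_add[symmetric] mult.assoc[symmetric])
        finally have "2 powr (q - 1) * \<alpha> k powr q * t \<delta> k powr q \<le> \<theta>2 k * \<upsilon> \<delta> k * t \<delta> k powr q"
          by (rule mult_right_mono) simp
        with 1 show ?thesis using t constants(8) by (simp add: powr_mult mult_ac)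
      qed
      have cone: "norm (F y - F (w \<delta> k) - L (w \<delta> k) (y - w \<delta> k)) \<le> \<eta> * norm (F y - F (w \<delta> k))"
        using a5(4)[OF w_dom] y(1) y_ball(1) by blast
      have "breg (\<gamma> \<delta> (Suc k)) y \<le> breg (\<xi> \<delta> k) y - \<theta>5 * \<upsilon> \<delta> k * \<rho> k powr s"
        unfolding it(8) \<theta>5(1) \<rho>_def it(5) w
      proof (rule descent[where F = F and vd = "v\<delta> \<delta>" and y = y and s = s,
            OF V_smooth exponents(3) y(1) data])
      qed (use \<rho> \<rho>_pos constants(1,5,8) a5(2) cone stability[OF breg_\<xi>] a4(1) \<upsilon>
          \<alpha>[THEN conjunct1] \<alpha>[THEN conjunct2] in \<open>simp_all add: \<rho>_def A_def it(5,6) w\<close>)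
      \<comment> \<open>As \<open>\<zeta> > 1\<close>, the increase \<open>T k\<close> caused by
        extrapolation is no larger than the decrease of the step.\<close>
      moreover have "\<theta>5 * \<upsilon> \<delta> k / \<zeta> * \<rho> k powr s \<le> \<theta>5 * \<upsilon> \<delta> k * \<rho> k powr s"
        using \<theta>5(2) \<upsilon>(1) constants(6) by (intro mult_right_mono) (simp_all add: field_simps)
      ultimately have "breg (\<gamma> \<delta> (Suc k)) y \<le> breg (\<gamma> \<delta> k) y"
        using extrapolation[OF IH(1)] T_le(1)[of k] by linarith
      then show ?case using IH(2) by (simp add: prev_def)
    qed
    define K where "K = kstop \<delta>"
    have \<rho>: "\<rho> K \<le> \<tau> * \<delta>" using discrepancy(1)[OF \<delta>] by (simp add: \<rho>_def it(5) K_def)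
    then have "\<upsilon> \<delta> K = 0" by (simp add: it(7) step_size_def \<rho>_def)
    then have "T K \<le> 0" using T_le(1)[of K] by simp
    \<comment> \<open>With zero step size the first bound on the parameters forces
      \<open>T K \<le> 0\<close>, whereas a genuine extrapolation has both factors of
      \<open>T K\<close> positive. So the residual tested at \<open>w\<close> is that of the iterate
      itself.\<close>
    have \<xi>_eq: "\<xi> \<delta> K = \<gamma> \<delta> K"
    proof (rule ccontr)
      assume "\<xi> \<delta> K \<noteq> \<gamma> \<delta> K"
      then have "lam \<delta> K \<noteq> 0" "norm (\<gamma> \<delta> K - prev \<gamma>0 (\<gamma> \<delta>) K) > 0" by (auto simp: it(3))
      moreover have "lam \<delta> K \<ge> 0" by (rule constants(10)[OF \<delta>0])
      ultimately have "T K > 0" unfolding T_def using q_gt_1 a2(3)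
        by (intro mult_pos_pos divide_pos_pos add_pos_nonneg) auto
      with \<open>T K \<le> 0\<close> show False by simp
    qed
    have w: "grad_conjugate \<phi> (\<gamma> \<delta> K) = w \<delta> K" using it(4)[of K] \<xi>_eq by simp
    have "breg (\<gamma> \<delta> K) y \<le> c0 * \<epsilon> powr p" using monotone[of K] by (simp add: K_def)
    moreover have "0 \<le> c0 * \<epsilon> powr p" using a2(3) by simp
    ultimately have "breg (\<gamma> \<delta> K) y \<le> C * norm (F y - F (w \<delta> K)) powr p"
      using stability[of "\<gamma> \<delta> K"] unfolding w by linarith
    \<comment> \<open>Comparison through \<open>v\<delta> \<delta>\<close>: the data error
      contributes \<open>\<delta>\<close>, the discrepancy principle
      \<open>\<tau> * \<delta>\<close>.\<close>
    also have "norm (F y - F (w \<delta> K)) \<le> (\<tau> + 1) * \<delta>"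
      using norm_triangle_ineq4[of "F y - v\<delta> \<delta>" "r \<delta> K"] data \<rho>
      by (simp add: it(5) \<rho>_def algebra_simps)
    then have "C * norm (F y - F (w \<delta> K)) powr p \<le> C * ((\<tau> + 1) * \<delta>) powr p"
      using a4(1) exponents(1) by (intro mult_left_mono powr_mono2) auto
    finally show ?thesis by (simp add: K_def)
  qed

  have pos: "\<forall>\<^sub>F \<delta> in at_right (0::real). \<delta> > 0" by (rule eventually_at_right_less)
  have lim: "((\<lambda>\<delta>. (\<tau> + 1) * \<delta>) \<longlongrightarrow> 0) (at_right (0::real))"
    by (auto intro!: tendsto_eq_intros)
  have "((\<lambda>\<delta>. ((\<tau> + 1) * \<delta>) powr p) \<longlongrightarrow> 0) (at_right 0)"
    using pos constants(1) exponents(1)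
    by (intro tendsto_zero_powrI[OF lim tendsto_const]) (auto elim: eventually_mono)
  then have lim_p: "((\<lambda>\<delta>. C * ((\<tau> + 1) * \<delta>) powr p) \<longlongrightarrow> 0) (at_right 0)"
    by (rule tendsto_mult_right_zero)
  have "((\<lambda>\<delta>. breg (\<gamma> \<delta> (kstop \<delta>)) y) \<longlongrightarrow> 0) (at_right 0)"
    by (rule tendsto_sandwich[OF _ _ tendsto_const lim_p])
      (use breg_nonneg[OF y(1)] eventually_mono[OF pos stop] in simp_all)
  then have "((\<lambda>\<delta>. ereal (breg (\<gamma> \<delta> (kstop \<delta>)) y)) \<longlongrightarrow> 0) (at_right 0)"
    by (simp add: zero_ereal_def)
  moreover have "\<forall>\<^sub>F \<delta> in at_right 0. ereal (breg (\<gamma> \<delta> (kstop \<delta>)) y)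
      = bregman \<phi> (\<gamma> \<delta> (kstop \<delta>)) y (u \<delta> (kstop \<delta>))"
    using pos by (rule eventually_mono) (simp add: u_eq bregman_eq_breg[OF y(1)])
  ultimately have 1: "((\<lambda>\<delta>. bregman \<phi> (\<gamma> \<delta> (kstop \<delta>)) y (u \<delta> (kstop \<delta>))) \<longlongrightarrow> 0) (at_right 0)"
    by (rule Lim_transform_eventually)
  have bound: "norm (u \<delta> (kstop \<delta>) - y) \<le> (C / c0) powr (1 / p) * ((\<tau> + 1) * \<delta>)" if "\<delta> > 0" for \<delta>
    using norm_le_of_breg_le[OF y(1) stop[OF that]] that constants(1) a4(1)
    by (simp add: u_eq norm_minus_commute)
  have 2: "((\<lambda>\<delta>. norm (u \<delta> (kstop \<delta>) - y)) \<longlongrightarrow> 0) (at_right 0)"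
    by (rule tendsto_sandwich[OF _ _ tendsto_const tendsto_mult_right_zero[OF lim]])
      (use eventually_mono[OF pos bound] in simp_all)
  show ?thesis
    using 1 2 y y_ball(2) a3(4) by (intro bexI[of _ y]) (auto simp: y_def)
qed

end
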